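(* There is an absolute constant $C>0$ such that the following holds. For every integer $k\ge 1$ there exists $n_0(k)$ such that for all integers $n\ge n_0(k)$ we have $\hat r^k(C_n)\le e^{Ck}\,n$ (i.e. $\hat r^k(C_n)=e^{O(k)}n$).
   Context: $C_n$ denotes the cycle on $n$ vertices. For a graph $H$ and an integer $k\ge1$, the size-Ramsey number $\hat r^k(H)$ is the smallest number of edges of a graph $G$ such that every colouring of the edges of $G$ with $k$ colours contains a monochromatic (not necessarily induced) copy of $H$. The implied constant in the $O(\cdot)$ notation is absolute (independent of $k$ and $n$). *)

theory Defs
  imports Complex_Main "HOL-Library.Ramsey" "HOL-Library.Extended_Real"
begin

record 'a ugraph =
  uverts :: "'a set"
  uedges :: "'a set set"

definition simple_graph :: "'a ugraph \<Rightarrow> bool" where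
  "simple_graph G \<longleftrightarrow> finite (uverts G) \<and> uedges G \<subseteq> nsets (uverts G) 2"

text \<open>The cycle on the vertices \<open>0, \<dots>, n - 1\<close>; a simple graph only for \<open>n \<ge> 3\<close>.\<close>

definition cycle_graph :: "nat \<Rightarrow> nat ugraph" where
  "cycle_graph n = \<lparr>uverts = {..<n}, uedges = (\<lambda>i. {i, Suc i mod n}) ` {..<n}\<rparr>"

definition contains_copy :: "'a ugraph \<Rightarrow> 'b ugraph \<Rightarrow> bool" where
  "contains_copy G H \<longleftrightarrow>
     (\<exists>f. inj_on f (uverts H) \<and> f ` uverts H \<subseteq> uverts G \<and> (\<forall>e\<in>uedges H. f ` e \<in> uedges G))"

definition colour_class :: "'a ugraph \<Rightarrow> ('a set \<Rightarrow> nat) \<Rightarrow> nat \<Rightarrow> 'a ugraph" where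
  "colour_class G \<chi> i = \<lparr>uverts = uverts G, uedges = {e \<in> uedges G. \<chi> e = i}\<rparr>"

definition ramsey_for :: "nat \<Rightarrow> 'a ugraph \<Rightarrow> 'b ugraph \<Rightarrow> bool" where
  "ramsey_for k G H \<longleftrightarrow>
     (\<forall>\<chi>. \<chi> ` uedges G \<subseteq> {..<k} \<longrightarrow> (\<exists>i<k. contains_copy (colour_class G \<chi> i) H))"

text \<open>
  Host graphs have natural numbers as vertices, which is no restriction for finite graphs.
  The value lies in \<^typ>\<open>enat\<close> so that the infimum over an empty family would be
  \<open>\<infinity>\<close> (in \<^typ>\<open>nat\<close> it would be \<open>0\<close>); over a nonempty family
  the infimum is a minimum, see \<open>size_ramsey_le_iff\<close>.
\<close>

definition size_ramsey :: "nat \<Rightarrow> 'a ugraph \<Rightarrow> enat" where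
  "size_ramsey k H =
     (INF G \<in> {G :: nat ugraph. simple_graph G \<and> ramsey_for k G H}. enat (card (uedges G)))"

lemma size_ramsey_le_iff:
  "size_ramsey k H \<le> enat m \<longleftrightarrow>
     (\<exists>G :: nat ugraph. simple_graph G \<and> ramsey_for k G H \<and> card (uedges G) \<le> m)"
  (is "_ \<longleftrightarrow> ?R")
proof
  let ?A = "{G :: nat ugraph. simple_graph G \<and> ramsey_for k G H}"
  let ?S = "(\<lambda>G. enat (card (uedges G))) ` ?A"
  assume le: "size_ramsey k H \<le> enat m"
  have "?S \<noteq> {}"
  proof
    assume "?S = {}"
    then have "size_ramsey k H = \<infinity>"
      by (simp only: size_ramsey_def Inf_enat_def simp_thms if_True)
    with le show False by simp
  qed
  then have "Inf ?S \<in> ?S"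
    by (metis (mono_tags, lifting) LeastI_ex Inf_enat_def ex_in_conv)
  then show ?R using le unfolding size_ramsey_def by auto
next
  assume ?R
  then obtain G :: "nat ugraph" where
    G: "simple_graph G" "ramsey_for k G H" "card (uedges G) \<le> m" by blast
  have "size_ramsey k H \<le> enat (card (uedges G))"
    unfolding size_ramsey_def using G by (intro INF_lower) simp
  with G(3) show "size_ramsey k H \<le> enat m"
    by (meson enat_ord_simps(1) order_trans)
qed

lemma simple_graph_cycle_graph:
  assumes "n \<ge> 3"
  shows "simple_graph (cycle_graph n)"
proof -
  have "i \<noteq> Suc i mod n" if "i < n" for i
    using that assms by (cases "Suc i = n") auto
  then show ?thesis
    using assms by (auto simp: simple_graph_def cycle_graph_def nsets_def card_insert_if)
qed

end

(*
  The host is a graph on L n vertices, L = 2 * 600^k, with at most 3 L^3 n edges and an edge between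
  any two disjoint sets of n vertices; a union bound over random edge sequences gives one.

  Suppose that its edges are k-coloured.  In every vertex set of size 2 * 100^k n some colour i has,
  at some scale mu >= n, two disjoint sets of size 100 mu with an i-edge between any two mu-subsets:
  otherwise shrink both sides 100-fold once per colour, losing that colour each time, until no edge
  is left.  After cleaning, any two vertices of such a pair are joined inside it by i-paths of every
  admissible length near n with the parity forced by the bipartition.  Call this an i-linked set; it
  contains C_n for even n.

  For odd n, grow from an i-linked set Q disjoint trees of bounded size rooted in Q, by adding
  matchings of i-edges as long as these enlarge the set by half.  If an i-edge between two different
  trees has the wrong parity, it closes an odd path through the trees to an i-coloured C_n.
  Otherwise a sixth of the vertices seen can be kept such that the i-components met there lie in
  single trees, which are too small to contain an i-linked set.  Iterating, each colour costs a
  factor 6, and 2 * 100^k n vertices without any linked set remain, a contradiction.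
*)

theory Submission
  imports Defs
begin

section \<open>Paths as vertex lists, and the cycles they close to\<close>

definition gpath :: "'a set set \<Rightarrow> 'a list \<Rightarrow> bool" where
  "gpath E p \<longleftrightarrow> distinct p \<and> successively (\<lambda>x y. {x, y} \<in> E) p"

lemma gpath_rev: "gpath E p \<Longrightarrow> gpath E (rev p)"
  by (simp add: gpath_def insert_commute)

lemma gpath_append:
  assumes "gpath E p" "gpath E q" "p \<noteq> []" "q \<noteq> []" "{last p, hd q} \<in> E" "set p \<inter> set q = {}"
  shows "gpath E (p @ q)"
  using assms by (auto simp: gpath_def successively_append_iff)

lemma gpath_take_drop: "gpath E p \<Longrightarrow> gpath E (take i (drop j p))"
  unfolding gpath_def
  by (metis append_take_drop_id distinct_append successively_append_iff)

lemma gpath_mono: "gpath E p \<Longrightarrow> E \<subseteq> F \<Longrightarrow> gpath F p"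
  unfolding gpath_def by (meson subset_eq successively_mono)

lemma successively_crossing:
  assumes "successively R p" "p \<noteq> []" "hd p \<in> Z" "last p \<notin> Z"
  shows "\<exists>x\<in>set p \<inter> Z. \<exists>y\<in>set p - Z. R x y"
  using assms
proof (induction p)
  case (Cons a p)
  then show ?case
    by (cases "p = []"; cases "hd p \<in> Z") (auto simp: successively_Cons)
qed simp

lemma contains_cycle:
  assumes "gpath E p" "set p \<subseteq> V" "{last p, hd p} \<in> E" "p \<noteq> []"
  shows "contains_copy \<lparr>uverts = V, uedges = E\<rparr> (cycle_graph (length p))"
  unfolding contains_copy_def
proof (intro exI[of _ "\<lambda>i. p ! i"] conjI)
  have d: "distinct p" and s: "successively (\<lambda>x y. {x, y} \<in> E) p"
    using assms(1) by (auto simp: gpath_def)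
  show "inj_on ((!) p) (uverts (cycle_graph (length p)))"
    using d by (auto simp: cycle_graph_def inj_on_def nth_eq_iff_index_eq)
  show "(!) p ` uverts (cycle_graph (length p)) \<subseteq> uverts \<lparr>uverts = V, uedges = E\<rparr>"
    using assms(2) by (auto simp: cycle_graph_def)
  have "{p ! i, p ! (Suc i mod length p)} \<in> E" if "i < length p" for i
  proof (cases "Suc i = length p")
    case True
    then have "p ! i = last p" using assms(4) by (metis diff_Suc_1 last_conv_nth)
    then show ?thesis using True assms(3,4) by (simp add: hd_conv_nth)
  next
    case False
    then show ?thesis using that s by (simp add: successively_conv_nth)
  qed
  then show "\<forall>e\<in>uedges (cycle_graph (length p)). (!) p ` e \<in> uedges \<lparr>uverts = V, uedges = E\<rparr>"
    by (auto simp: cycle_graph_def)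
qed

section \<open>A sparse host graph by a union bound\<close>

text \<open>Count sequences of \<open>M\<close> ordered pairs of vertices. At most a fraction
  \<open>(1 - 1 / L ^ 2) ^ M\<close>, hence at most \<open>exp (-3) ^ N\<close>, of them miss a
  given product \<open>A \<times> B\<close> of large sets, and there are at most
  \<open>4 ^ N\<close> such products. As \<open>4 * exp (-3) < 1\<close>, some sequence hits every
  product; its pairs serve as edges.\<close>

lemma sparse_joined_graph:
  fixes L n :: nat
  assumes "L \<ge> 1" "n \<ge> 1"
  shows "\<exists>E. E \<subseteq> nsets {..<L * n} 2 \<and> card E \<le> 3 * L ^ 3 * n \<and>
    (\<forall>X Y. X \<subseteq> {..<L * n} \<and> Y \<subseteq> {..<L * n} \<and> X \<inter> Y = {} \<and> n \<le> card X \<and> n \<le> card Y \<longrightarrow>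
      (\<exists>x\<in>X. \<exists>y\<in>Y. {x, y} \<in> E))"
proof -
  define N where "N = L * n"
  define M where "M = 3 * N * L\<^sup>2"
  define V where "V = {..<N}"
  define I where "I = {(A, B). A \<subseteq> V \<and> B \<subseteq> V \<and> n \<le> card A \<and> n \<le> card B}"
  define bad where "bad = (\<lambda>(A, B). PiE {..<M} (\<lambda>_. V \<times> V - A \<times> B))"
  have fV: "finite V" and cV: "card V = N" by (auto simp: V_def)
  have N1: "N \<ge> 1" using assms by (simp add: N_def)
  have I_sub: "I \<subseteq> Pow V \<times> Pow V" by (auto simp: I_def)
  have fI: "finite I" using I_sub fV by (meson finite_Pow_iff finite_SigmaI finite_subset)
  have cI: "card I \<le> 4 ^ N"
  proof -
    have "card I \<le> card (Pow V \<times> Pow V)" by (rule card_mono) (use I_sub fV in auto)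
    also have "\<dots> = 4 ^ N"
      by (simp add: card_cartesian_product card_Pow fV cV flip: power_mult_distrib)
    finally show ?thesis .
  qed
  have cbad: "card (bad ab) \<le> (N\<^sup>2 - n\<^sup>2) ^ M" if "ab \<in> I" for ab
  proof -
    obtain A B where ab: "ab = (A, B)" by force
    have AB: "A \<subseteq> V" "B \<subseteq> V" "n \<le> card A" "n \<le> card B" using that ab by (auto simp: I_def)
    have "card (V \<times> V - A \<times> B) = N\<^sup>2 - card A * card B"
      using AB fV finite_subset[OF _ fV]
      by (subst card_Diff_subset) (auto simp: card_cartesian_product cV power2_eq_square)
    also have "\<dots> \<le> N\<^sup>2 - n\<^sup>2"
      using AB by (intro diff_le_mono2) (simp add: power2_eq_square mult_le_mono)
    finally show ?thesis using ab by (simp add: bad_def card_PiE power_mono)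
  qed
  have "card (\<Union>ab\<in>I. bad ab) \<le> (\<Sum>ab\<in>I. card (bad ab))" by (rule card_UN_le[OF fI])
  also have "\<dots> \<le> (\<Sum>ab\<in>I. (N\<^sup>2 - n\<^sup>2) ^ M)" by (rule sum_mono) (rule cbad)
  also have "\<dots> \<le> 4 ^ N * (N\<^sup>2 - n\<^sup>2) ^ M" using cI by simp
  also have "\<dots> < (N\<^sup>2) ^ M"
  proof -
    have nN: "n\<^sup>2 \<le> N\<^sup>2" using assms by (intro power_mono) (auto simp: N_def)
    have L0: "real L > 0" using assms by simp
    have "real (N\<^sup>2 - n\<^sup>2) = (real N)\<^sup>2 * (1 - 1 / (real L)\<^sup>2)"
      using nN L0 assms by (simp add: of_nat_diff N_def power_mult_distrib field_simps)
    also have "\<dots> \<le> (real N)\<^sup>2 * exp (- 1 / (real L)\<^sup>2)"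
      using exp_ge_add_one_self[of "- 1 / (real L)\<^sup>2"] by (intro mult_left_mono) auto
    finally have 1: "real (N\<^sup>2 - n\<^sup>2) ^ M \<le> ((real N)\<^sup>2 * exp (- 1 / (real L)\<^sup>2)) ^ M"
      by (rule power_mono) simp
    have "exp (- 1 / (real L)\<^sup>2) ^ M = exp (real M * (- 1 / (real L)\<^sup>2))"
      by (rule exp_of_nat_mult[symmetric])
    also have "real M * (- 1 / (real L)\<^sup>2) = real N * (-3)"
      using L0 by (simp add: M_def)
    also have "exp (real N * (-3)) = exp (-3) ^ N" by (rule exp_of_nat_mult)
    finally have 2: "exp (- 1 / (real L)\<^sup>2) ^ M = exp (-3) ^ N" .
    have "exp (1::real) \<ge> 2" using exp_ge_add_one_self[of 1] by simp
    then have "exp (1::real) ^ 3 \<ge> 2 ^ 3" by (intro power_mono) auto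
    then have "exp (3::real) \<ge> 8" by (simp flip: exp_of_nat_mult)
    then have "4 * exp (-3 :: real) < 1" by (simp add: exp_minus field_simps)
    then have 3: "(4 * exp (-3 :: real)) ^ N < 1"
      using N1 by (subst power_less_one_iff) auto
    have "real (4 ^ N * (N\<^sup>2 - n\<^sup>2) ^ M) = 4 ^ N * real (N\<^sup>2 - n\<^sup>2) ^ M" by simp
    also have "\<dots> \<le> 4 ^ N * ((real N)\<^sup>2 * exp (- 1 / (real L)\<^sup>2)) ^ M"
      using 1 by simp
    also have "\<dots> = (4 * exp (-3 :: real)) ^ N * ((real N)\<^sup>2) ^ M"
      by (simp only: power_mult_distrib 2 mult_ac)
    also have "\<dots> < 1 * ((real N)\<^sup>2) ^ M"
      using 3 N1 by (intro mult_strict_right_mono) auto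
    finally show ?thesis by (metis mult_1 of_nat_less_iff of_nat_power)
  qed
  also have "\<dots> = card (PiE {..<M} (\<lambda>_. V \<times> V))"
    by (simp add: card_PiE card_cartesian_product cV power2_eq_square)
  finally have "\<not> PiE {..<M} (\<lambda>_. V \<times> V) \<subseteq> (\<Union>ab\<in>I. bad ab)"
    by (metis (no_types, lifting) card_mono fI finite_UN_I finite_PiE finite_lessThan fV
        finite_Diff finite_SigmaI bad_def case_prod_unfold leD)
  then obtain w where w: "w \<in> PiE {..<M} (\<lambda>_. V \<times> V)" "\<And>ab. ab \<in> I \<Longrightarrow> w \<notin> bad ab" by blast
  \<comment> \<open>Intersecting with \<open>nsets V 2\<close> discards loops; a pair hitting
    \<open>X \<times> Y\<close> for disjoint \<open>X\<close> and \<open>Y\<close> has distinct ends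
    and survives.\<close>
  define E where "E = (\<lambda>j. {fst (w j), snd (w j)}) ` {..<M} \<inter> nsets V 2"
  have "card E \<le> card ((\<lambda>j. {fst (w j), snd (w j)}) ` {..<M})"
    unfolding E_def by (rule card_mono) auto
  also have "\<dots> \<le> M" using card_image_le[of "{..<M}"] by fastforce
  also have "M = 3 * L ^ 3 * n" by (simp add: M_def N_def power3_eq_cube power2_eq_square)
  finally have "card E \<le> 3 * L ^ 3 * n" .
  moreover have "\<exists>x\<in>X. \<exists>y\<in>Y. {x, y} \<in> E"
    if "X \<subseteq> V" "Y \<subseteq> V" "X \<inter> Y = {}" "n \<le> card X" "n \<le> card Y" for X Y
  proof -
    have "w \<notin> bad (X, Y)" using that by (intro w) (simp add: I_def)
    then obtain j where "j < M" "w j \<in> X \<times> Y"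
      using w(1) by (auto simp: bad_def PiE_iff)
    then show ?thesis
      using that by (intro bexI[of _ "fst (w j)"] bexI[of _ "snd (w j)"])
        (auto simp: E_def nsets_def mem_Times_iff card_insert_if)
  qed
  ultimately show ?thesis
    by (intro exI[of _ E]) (auto simp: E_def V_def N_def)
qed

section \<open>Depth-first search\<close>

text \<open>State of the search after \<open>j\<close> moves: \<open>S\<close> is finished,
  \<open>p\<close> is the stack with its top at the head, \<open>T\<close> is unvisited. A move
  pushes a neighbour of the top, or any vertex if the stack is empty; a top without neighbours in
  \<open>T\<close> is retired to \<open>S\<close>. Each move raises
  \<open>2 * card S + length p\<close> by exactly one, so the search can be stopped at any value of
  this potential.\<close>

lemma depth_first_search:
  assumes "finite W" "j \<le> 2 * card W"
  shows "\<exists>S p T. S \<union> set p \<union> T = W \<and> S \<inter> set p = {} \<and> S \<inter> T = {} \<and> set p \<inter> T = {} \<and>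
    gpath E p \<and> (\<forall>x\<in>S. \<forall>y\<in>T. {x, y} \<notin> E) \<and> 2 * card S + length p = j"
  using assms(2)
proof (induction j)
  case 0
  show ?case by (intro exI[of _ "{}"] exI[of _ "[]"] exI[of _ W]) (auto simp: gpath_def)
next
  case (Suc j)
  then obtain S p T where st: "S \<union> set p \<union> T = W" "S \<inter> set p = {}" "S \<inter> T = {}" "set p \<inter> T = {}"
    "gpath E p" "\<forall>x\<in>S. \<forall>y\<in>T. {x, y} \<notin> E" "2 * card S + length p = j" by auto
  have fS: "finite S" using st(1) assms(1) by (metis finite_Un)
  show ?case
  proof (cases p)
    case Nil
    then have "T \<noteq> {}" using st Suc.prems by auto
    then obtain y where "y \<in> T" by blast
    then show ?thesis using st Nil
      by (intro exI[of _ S] exI[of _ "[y]"] exI[of _ "T - {y}"]) (auto simp: gpath_def)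
  next
    case (Cons x q)
    show ?thesis
    proof (cases "\<exists>y\<in>T. {y, x} \<in> E")
      case True
      then obtain y where "y \<in> T" "{y, x} \<in> E" by blast
      then show ?thesis using st Cons
        by (intro exI[of _ S] exI[of _ "y # p"] exI[of _ "T - {y}"]) (auto simp: gpath_def)
    next
      case False
      have "x \<notin> S" using st(2) Cons by auto
      then show ?thesis using st Cons False fS
        by (intro exI[of _ "insert x S"] exI[of _ q] exI[of _ T])
          (auto simp: gpath_def successively_Cons insert_commute)
    qed
  qed
qed

section \<open>Joined and expanding bipartite pairs\<close>

definition nb :: "'a set set \<Rightarrow> 'a set \<Rightarrow> 'a set \<Rightarrow> 'a set" where
  "nb E X Y = {y \<in> Y. \<exists>x\<in>X. {x, y} \<in> E}"

definition joined :: "'a set set \<Rightarrow> nat \<Rightarrow> (bool \<Rightarrow> 'a set) \<Rightarrow> bool" where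
  "joined E \<mu> W \<longleftrightarrow> (\<forall>s X Y. X \<subseteq> W s \<and> Y \<subseteq> W (\<not> s) \<and> \<mu> \<le> card X \<and> \<mu> \<le> card Y \<longrightarrow>
     (\<exists>x\<in>X. \<exists>y\<in>Y. {x, y} \<in> E))"

text \<open>The factor 10 leaves room to double the layers of two binary trees while keeping the
  trees disjoint.\<close>

definition expanding :: "'a set set \<Rightarrow> nat \<Rightarrow> (bool \<Rightarrow> 'a set) \<Rightarrow> bool" where
  "expanding E \<mu> W \<longleftrightarrow> (\<forall>s X. X \<subseteq> W s \<and> X \<noteq> {} \<and> card X \<le> 2 * \<mu> \<longrightarrow>
     10 * card X \<le> card (nb E X (W (\<not> s))))"

lemma expandingD:
  assumes "expanding E \<mu> W" "X \<subseteq> W s" "X \<noteq> {}" "card X \<le> 2 * \<mu>"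
  shows "10 * card X \<le> card (nb E X (W (\<not> s)))"
  using assms by (simp add: expanding_def)

lemma joined_mono: "joined E \<mu> W \<Longrightarrow> (\<And>s. W' s \<subseteq> W s) \<Longrightarrow> joined E \<mu> W'"
  unfolding joined_def by (meson order_trans)

lemma joined_nonneighbours:
  assumes "joined E \<mu> W" "X \<subseteq> W s" "\<mu> \<le> card X" "1 \<le> \<mu>"
  shows "card (W (\<not> s) - nb E X (W (\<not> s))) < \<mu>"
proof (rule ccontr)
  assume "\<not> ?thesis"
  then have "\<exists>x\<in>X. \<exists>y\<in>W (\<not> s) - nb E X (W (\<not> s)). {x, y} \<in> E"
    using assms unfolding joined_def by (metis Diff_subset not_less)
  then show False by (auto simp: nb_def)
qed

text \<open>Delete a largest pair \<open>D\<close> with fewer than \<open>2 * \<mu>\<close> vertices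
  and at most \<open>10 * w D\<close> outside neighbours. A set violating expansion in the rest
  could be added to \<open>D\<close>, so the enlarged pair must be too large. Then one of its sides
  has at least \<mu> vertices and sees all but \<mu> of the opposite side, which leaves that
  opposite side with fewer than \<open>45 * \<mu>\<close> vertices.\<close>

lemma joined_imp_expanding:
  assumes fin: "\<And>s. finite (W s)" and J: "joined E \<mu> W"
    and big: "\<And>s. 100 * \<mu> \<le> card (W s)" and \<mu>: "1 \<le> \<mu>"
  shows "\<exists>W'. (\<forall>s. W' s \<subseteq> W s \<and> 98 * \<mu> \<le> card (W' s)) \<and> expanding E \<mu> W'"
proof -
  define w where "w = (\<lambda>D :: bool \<Rightarrow> 'a set. card (D True) + card (D False))"
  define g where "g = (\<lambda>D s. card (nb E (D s) (W (\<not> s)) - D (\<not> s)))"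
  define P where "P = (\<lambda>D. (\<forall>s. D s \<subseteq> W s) \<and> w D < 2 * \<mu> \<and> g D True + g D False \<le> 10 * w D)"
  have w: "w D = card (D s) + card (D (\<not> s))" for D s by (cases s) (auto simp: w_def)
  have g: "g D True + g D False = g D s + g D (\<not> s)" for D s by (cases s) auto
  have "P (\<lambda>_. {})" using \<mu> by (auto simp: P_def w_def g_def nb_def)
  moreover have "\<forall>D. P D \<longrightarrow> w D < 2 * \<mu>" by (simp add: P_def)
  ultimately obtain D where D: "P D" and Dmax: "\<And>D'. P D' \<Longrightarrow> w D' \<le> w D"
    using ex_has_greatest_nat[of P "\<lambda>_. {}" w "2 * \<mu>"] by blast
  have Dsub: "D s \<subseteq> W s" for s using D by (simp add: P_def)
  have finD: "finite (D s)" for s using Dsub fin finite_subset by metis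
  define W' where "W' = (\<lambda>s. W s - D s)"
  have "10 * card X \<le> card (nb E X (W' (\<not> s)))"
    if X: "X \<subseteq> W' s" "X \<noteq> {}" "card X \<le> 2 * \<mu>" for s X
  proof (rule ccontr)
    assume neg: "\<not> ?thesis"
    have finX: "finite X" using X(1) fin by (metis W'_def finite_Diff finite_subset)
    define D' where "D' = D(s := D s \<union> X)"
    have D's: "D' s = D s \<union> X" "D' (\<not> s) = D (\<not> s)" by (auto simp: D'_def)
    have "D s \<inter> X = {}" using X(1) by (auto simp: W'_def)
    then have cD's: "card (D' s) = card (D s) + card X"
      by (simp add: D's card_Un_disjoint finD finX)
    have wD': "w D' = w D + card X" using cD's by (simp add: w[of _ s] D's)
    have D'sub: "D' t \<subseteq> W t" for t
      using Dsub X(1) by (auto simp: D'_def W'_def)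
    have finD': "finite (D' t)" for t using D'sub fin finite_subset by metis
    \<comment> \<open>Neighbours in \<open>D (\<not> s)\<close> are not counted, so \<open>X\<close>
      contributes only those in \<open>W' (\<not> s)\<close>. For the other side, enlarging
      \<open>D s\<close> can only lower the count.\<close>
    have "g D' s \<le> card ((nb E (D s) (W (\<not> s)) - D (\<not> s)) \<union> nb E X (W' (\<not> s)))"
      unfolding g_def by (intro card_mono) (auto simp: D's nb_def W'_def fin)
    also have "\<dots> \<le> g D s + card (nb E X (W' (\<not> s)))"
      unfolding g_def by (rule card_Un_le)
    finally have g1: "g D' s \<le> g D s + card (nb E X (W' (\<not> s)))" .
    have g2: "g D' (\<not> s) \<le> g D (\<not> s)"
      unfolding g_def by (intro card_mono) (auto simp: D's nb_def fin)
    have gD: "g D s + g D (\<not> s) \<le> 10 * w D" using D g[of D s] by (simp add: P_def)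
    have gD': "g D' True + g D' False \<le> 10 * w D'"
      using g1 g2 gD neg wD' g[of D' s] by simp
    have "card X > 0" using X(2) finX by (simp add: card_gt_0_iff)
    then have "\<not> P D'" using Dmax[of D'] wD' by auto
    \<comment> \<open>Inclusions and neighbourhood bound persist for \<open>D'\<close>, so it can
      violate \<open>P\<close> only by its size.\<close>
    then have ge: "2 * \<mu> \<le> w D'" using gD' D'sub by (auto simp: P_def)
    have lt: "w D' < 4 * \<mu>" using wD' X(3) D by (simp add: P_def)
    obtain t where t: "\<mu> \<le> card (D' t)"
    proof (cases "\<mu> \<le> card (D' True)")
      case False
      then have "\<mu> \<le> card (D' False)" using ge by (simp add: w_def)
      then show ?thesis by (rule that)
    qed (rule that)
    have "card (W (\<not> t)) \<le> card ((W (\<not> t) - nb E (D' t) (W (\<not> t))) \<union>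
        (nb E (D' t) (W (\<not> t)) - D' (\<not> t)) \<union> D' (\<not> t))"
      by (intro card_mono) (auto simp: fin finD' nb_def)
    also have "\<dots> \<le> card (W (\<not> t) - nb E (D' t) (W (\<not> t))) + g D' t + card (D' (\<not> t))"
      unfolding g_def by (meson add_le_mono1 card_Un_le order_trans)
    also have "\<dots> < \<mu> + g D' t + card (D' (\<not> t))"
      using joined_nonneighbours[OF J D'sub t \<mu>] by simp
    also have "\<dots> \<le> \<mu> + 10 * w D' + w D'"
      using gD' g[of D' t] w[of D' t] by simp
    finally show False using lt big[of "\<not> t"] \<mu> by simp
  qed
  then have "expanding E \<mu> W'" by (simp add: expanding_def)
  moreover have "W' s \<subseteq> W s \<and> 98 * \<mu> \<le> card (W' s)" for s
  proof -
    have "card (W' s) = card (W s) - card (D s)"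
      unfolding W'_def by (rule card_Diff_subset) (use Dsub finD in auto)
    moreover have "card (D s) < 2 * \<mu>" using D w[of D s] by (simp add: P_def)
    ultimately show ?thesis using big[of s] by (auto simp: W'_def)
  qed
  ultimately show ?thesis by blast
qed

section \<open>Paths of prescribed length in expanding pairs\<close>

text \<open>
  \<open>T\<close> carries paths from \<open>a\<close> to all of the \<open>2 ^ j\<close> vertices of \<open>L\<close>, all of the same length:
  this is what gives control over exact path lengths.
\<close>

definition layered :: "'a set set \<Rightarrow> 'a \<Rightarrow> 'a set \<Rightarrow> 'a set \<Rightarrow> nat \<Rightarrow> bool" where
  "layered E a T L j \<longleftrightarrow> finite T \<and> L \<subseteq> T \<and> card L = 2 ^ j \<and> card T \<le> 2 * 2 ^ j \<and>
     (\<forall>u\<in>L. \<exists>p. gpath E p \<and> p \<noteq> [] \<and> hd p = a \<and> last p = u \<and> set p \<subseteq> T \<and> length p = Suc j)"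

lemma layered_Suc:
  assumes "layered E a T L j" "L' \<subseteq> nb E L Y" "L' \<inter> T = {}" "card L' = 2 ^ Suc j"
  shows "layered E a (T \<union> L') L' (Suc j)"
proof -
  have fL': "finite L'" using assms(4) by (metis card.infinite power_not_zero zero_neq_numeral)
  have "\<exists>p. gpath E p \<and> p \<noteq> [] \<and> hd p = a \<and> last p = v \<and> set p \<subseteq> T \<union> L' \<and> length p = Suc (Suc j)"
    if v: "v \<in> L'" for v
  proof -
    obtain u where u: "u \<in> L" "{u, v} \<in> E" using v assms(2) by (auto simp: nb_def)
    then obtain p where "gpath E p" "p \<noteq> []" "hd p = a" "last p = u" "set p \<subseteq> T" "length p = Suc j"
      using assms(1) by (auto simp: layered_def)
    moreover have "v \<notin> T" using v assms(3) by auto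
    ultimately show ?thesis using u v
      by (intro exI[of _ "p @ [v]"]) (auto simp: gpath_def successively_append_iff)
  qed
  then show ?thesis
    using assms fL' by (auto simp: layered_def card_Un_disjoint Int_commute)
qed

text \<open>The trees grow in turn, layer by layer. A layer of \<open>2 ^ h\<close> vertices has at
  least \<open>10 * 2 ^ h\<close> neighbours across, of which at most \<open>6 * 2 ^ h\<close> are
  occupied, so the next layer can be twice as large. Layers alternate between the sides:
  \<open>W (sa = even h)\<close> is side \<open>sa\<close> for even \<open>h\<close> and the
  opposite side for odd \<open>h\<close>.\<close>

lemma two_layered:
  assumes X: "expanding E \<mu> W"
    and "a \<in> W sa" "b \<in> W sb" "a \<noteq> b" "2 ^ h \<le> 4 * \<mu>"
  shows "\<exists>Ta La Tb Lb. layered E a Ta La h \<and> layered E b Tb Lb h \<and> Ta \<inter> Tb = {} \<and>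
    La \<subseteq> W (sa = even h) \<and> Lb \<subseteq> W (sb = even h) \<and> Ta \<union> Tb \<subseteq> W True \<union> W False"
  using assms(5)
proof (induction h)
  case 0
  have "W s \<subseteq> W True \<union> W False" for s by (cases s) auto
  then have "{a} \<union> {b} \<subseteq> W True \<union> W False" using assms(2,3) by blast
  moreover have "layered E c {c} {c} 0" for c
    by (auto simp: layered_def gpath_def intro!: exI[of _ "[c]"])
  ultimately show ?case using assms(2-4)
    by (intro exI[of _ "{a}"] exI[of _ "{b}"]) auto
next
  case (Suc h)
  then obtain Ta La Tb Lb where IH: "layered E a Ta La h" "layered E b Tb Lb h" "Ta \<inter> Tb = {}"
    "La \<subseteq> W (sa = even h)" "Lb \<subseteq> W (sb = even h)" "Ta \<union> Tb \<subseteq> W True \<union> W False" by auto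
  have h: "2 ^ h \<le> 2 * \<mu>" using Suc.prems by simp
  have step: "10 * 2 ^ h \<le> card (nb E L (W (s = even (Suc h))))"
    if L: "layered E c T L h" "L \<subseteq> W (s = even h)" for c T L s
  proof -
    have eq: "W (s = even (Suc h)) = W (\<not> (s = even h))" by (rule arg_cong[of _ _ W]) auto
    have "L \<noteq> {}" "card L = 2 ^ h" using L by (auto simp: layered_def)
    then show ?thesis using expandingD[OF X L(2)] h unfolding eq by simp
  qed
  have fT: "finite Ta" "finite Tb" "card Ta \<le> 2 * 2 ^ h" "card Tb \<le> 2 * 2 ^ h"
    using IH by (auto simp: layered_def)
  have cT: "card (Ta \<union> Tb) \<le> 4 * 2 ^ h" using card_Un_le[of Ta Tb] fT by simp
  have "2 ^ Suc h \<le> card (nb E La (W (sa = even (Suc h))) - (Ta \<union> Tb))"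
    using diff_card_le_card_Diff[of "Ta \<union> Tb" "nb E La (W (sa = even (Suc h)))"] fT cT
      step[OF IH(1,4)] by simp
  then obtain La' where La': "La' \<subseteq> nb E La (W (sa = even (Suc h))) - (Ta \<union> Tb)" "card La' = 2 ^ Suc h"
    by (meson obtain_subset_with_card_n)
  then have fLa': "finite La'" by (metis card.infinite power_not_zero zero_neq_numeral)
  have "card (Ta \<union> Tb \<union> La') \<le> 6 * 2 ^ h" using card_Un_le[of "Ta \<union> Tb" La'] cT La'(2) by simp
  then have "2 ^ Suc h \<le> card (nb E Lb (W (sb = even (Suc h))) - (Ta \<union> Tb \<union> La'))"
    using diff_card_le_card_Diff[of "Ta \<union> Tb \<union> La'" "nb E Lb (W (sb = even (Suc h)))"] fT fLa'
      step[OF IH(2,5)] by simp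
  then obtain Lb' where Lb': "Lb' \<subseteq> nb E Lb (W (sb = even (Suc h))) - (Ta \<union> Tb \<union> La')"
    "card Lb' = 2 ^ Suc h"
    by (meson obtain_subset_with_card_n)
  have sub: "La' \<subseteq> W (sa = even (Suc h))" "Lb' \<subseteq> W (sb = even (Suc h))"
    using La' Lb' by (auto simp: nb_def)
  have "layered E a (Ta \<union> La') La' (Suc h)"
    by (rule layered_Suc[OF IH(1) _ _ La'(2), of "W (sa = even (Suc h))"]) (use La'(1) in auto)
  moreover have "layered E b (Tb \<union> Lb') Lb' (Suc h)"
    by (rule layered_Suc[OF IH(2) _ _ Lb'(2), of "W (sb = even (Suc h))"]) (use Lb'(1) in auto)
  moreover have "(Ta \<union> La') \<inter> (Tb \<union> Lb') = {}" using IH(3) La'(1) Lb'(1) by blast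
  moreover have "W s \<subseteq> W True \<union> W False" for s by (cases s) auto
  then have "(Ta \<union> La') \<union> (Tb \<union> Lb') \<subseteq> W True \<union> W False" using IH(6) sub by blast
  ultimately show ?case using sub by blast
qed

text \<open>Depth-first search leaves no edge between finished and unvisited vertices. Joinedness
  makes one of the two sets small on each opposite pair of sides, so the stack holds most of some
  side.\<close>

lemma long_alternating_path:
  assumes fin: "\<And>s. finite (W s)" and disj: "W True \<inter> W False = {}" and J: "joined E \<mu> W"
    and big: "\<And>s. 90 * \<mu> \<le> card (W s)" and "1 \<le> \<mu>"
  shows "\<exists>p s. gpath E p \<and> set p \<subseteq> W True \<union> W False \<and> 88 * \<mu> \<le> length p \<and>
    (\<forall>i<length p. p ! i \<in> W (s = even i))"
proof -
  \<comment> \<open>Only edges across are searched, so that the stack alternates between the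
    sides.\<close>
  define E' where "E' = E \<inter> {{x, y} | x y. x \<in> W True \<and> y \<in> W False}"
  have fW: "finite (W True \<union> W False)" using fin by auto
  \<comment> \<open>Stopping at potential \<open>card W\<close> makes \<open>S\<close> and \<open>T\<close> equally large.\<close>
  from depth_first_search[OF fW, of "card (W True \<union> W False)" E']
  obtain S p T where st: "S \<union> set p \<union> T = W True \<union> W False" "S \<inter> set p = {}" "S \<inter> T = {}" "set p \<inter> T = {}"
    "gpath E' p" "\<forall>x\<in>S. \<forall>y\<in>T. {x, y} \<notin> E'" "2 * card S + length p = card (W True \<union> W False)" by auto
  have fS: "finite S" "finite T" using st(1) fW by (metis finite_Un)+
  have lp: "length p = card (set p)" using st(5) by (simp add: gpath_def distinct_card)
  have "card (W True \<union> W False) = card S + card (set p) + card T"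
    using st(1-4) fS by (metis card_Un_disjoint List.finite_set finite_Un Int_Un_distrib2 Un_empty)
  then have ST: "card S = card T" using st(7) lp by simp
  have cS: "card S = card (S \<inter> W True) + card (S \<inter> W False)"
    "card T = card (T \<inter> W True) + card (T \<inter> W False)"
    using st(1) disj fS by (subst card_Un_disjoint[symmetric]; auto intro!: arg_cong[of _ _ card])+
  have cW: "card (W True \<union> W False) = card (W True) + card (W False)"
    using disj fin by (simp add: card_Un_disjoint)
  have small: "card (S \<inter> W s) < \<mu> \<or> card (T \<inter> W (\<not> s)) < \<mu>" for s
  proof (rule ccontr)
    assume "\<not> ?thesis"
    then obtain x y where xy: "x \<in> S \<inter> W s" "y \<in> T \<inter> W (\<not> s)" "{x, y} \<in> E"
      using J unfolding joined_def by (metis Int_lower2 not_less)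
    then have "{x, y} \<in> E'" by (cases s) (auto simp: E'_def insert_commute)
    then show False using st(6) xy by auto
  qed
  have onp: "card (W s) \<le> card (S \<inter> W s) + card (set p) + card (T \<inter> W s)" for s
  proof -
    have "W s \<subseteq> S \<union> set p \<union> T" using st(1) by (cases s) auto
    then have "card (W s) \<le> card (S \<inter> W s \<union> set p \<union> T \<inter> W s)"
      by (intro card_mono) (use fS in auto)
    also have "\<dots> \<le> card (S \<inter> W s) + card (set p) + card (T \<inter> W s)"
      by (meson add_le_mono1 card_Un_le order_trans)
    finally show ?thesis .
  qed
  \<comment> \<open>If the two small parts both lie in \<open>S\<close> or both in \<open>T\<close>,
    then \<open>S\<close> and \<open>T\<close> have fewer than \<open>2 * \<mu>\<close> vertices
    each. Otherwise they lie in the same side \<open>W s\<close>, all but \<open>2 * \<mu>\<close>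
    of whose vertices are then on \<open>p\<close>; hence 88 = 90 - 2.\<close>
  have len: "88 * \<mu> \<le> length p"
    using small[of True] small[of False] cS ST onp[of True] onp[of False] big[of True] big[of False]
      st(7) cW lp by auto
  then have "p \<noteq> []" using \<open>1 \<le> \<mu>\<close> by auto
  have subW: "set p \<subseteq> W True \<union> W False" using st(1) by blast
  define s where "s = (hd p \<in> W True)"
  have "p ! i \<in> W (s = even i)" if "i < length p" for i
    using that
  proof (induction i)
    case 0
    then have "p ! 0 \<in> W True \<union> W False" using subW nth_mem by blast
    then show ?case using \<open>p \<noteq> []\<close> by (cases "p ! 0 \<in> W True") (auto simp: s_def hd_conv_nth)
  next
    case (Suc i)
    then have "{p ! i, p ! Suc i} \<in> E'"
      using st(5) by (auto simp: gpath_def successively_conv_nth)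
    then have "(p ! i \<in> W True \<and> p ! Suc i \<in> W False) \<or> (p ! i \<in> W False \<and> p ! Suc i \<in> W True)"
      by (auto simp: E'_def doubleton_eq_iff)
    moreover have "p ! i \<in> W (s = even i)" using Suc by simp
    ultimately show ?case using disj by (cases "s = even i") auto
  qed
  moreover have "gpath E p" using st(5) by (rule gpath_mono) (simp add: E'_def)
  ultimately show ?thesis using subW len by blast
qed

section \<open>Linked sets\<close>

text \<open>
  Lengths count vertices, not edges.  The slack \<open>t\<close> leaves room for the vertices of an ear outside
  \<open>Q\<close>.
\<close>

definition exact_paths :: "'a set set \<Rightarrow> nat \<Rightarrow> nat \<Rightarrow> 'a set \<Rightarrow> ('a \<Rightarrow> bool) \<Rightarrow> bool" where
  "exact_paths E n t Q sd \<longleftrightarrow>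
     (\<forall>a\<in>Q. \<forall>b\<in>Q. \<forall>l. a \<noteq> b \<longrightarrow> n \<le> l + t \<longrightarrow> l \<le> n \<longrightarrow> even l = (sd a \<noteq> sd b) \<longrightarrow>
       (\<exists>p. gpath E p \<and> set p \<subseteq> Q \<and> p \<noteq> [] \<and> hd p = a \<and> last p = b \<and> length p = l))"

lemma exact_pathsD:
  assumes "exact_paths E n t Q sd" "a \<in> Q" "b \<in> Q" "a \<noteq> b" "n \<le> l + t" "l \<le> n" "even l = (sd a \<noteq> sd b)"
  shows "\<exists>p. gpath E p \<and> set p \<subseteq> Q \<and> p \<noteq> [] \<and> hd p = a \<and> last p = b \<and> length p = l"
  using assms unfolding exact_paths_def by simp

text \<open>The edge with differently labelled ends closes an exact path to an even cycle. The bound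
  on \<open>card Q\<close> keeps a linked set from fitting into a small tree.\<close>

definition linked :: "'a set set \<Rightarrow> nat \<Rightarrow> nat \<Rightarrow> 'a set \<Rightarrow> bool" where
  "linked E n t Q \<longleftrightarrow> finite Q \<and> n \<le> card Q \<and>
     (\<exists>sd. (\<exists>a\<in>Q. \<exists>b\<in>Q. {a, b} \<in> E \<and> sd a \<noteq> sd b) \<and> exact_paths E n t Q sd)"

lemma linkedI:
  assumes "\<exists>a\<in>Q. \<exists>b\<in>Q. {a, b} \<in> E \<and> sd a \<noteq> sd b" "exact_paths E n t Q sd" "n \<le> card Q" "finite Q"
  shows "linked E n t Q"
proof -
  have "\<exists>sd. (\<exists>a\<in>Q. \<exists>b\<in>Q. {a, b} \<in> E \<and> sd a \<noteq> sd b) \<and> exact_paths E n t Q sd"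
    by (rule exI[of _ sd], rule conjI[OF assms(1,2)])
  with assms(3,4) show ?thesis unfolding linked_def by (intro conjI)
qed

text \<open>Trees of depth \<open>h\<close> from \<open>a\<close> and \<open>b\<close> end in layers
  of at least \<mu> vertices, which see almost all of their opposite sides. A segment of a long path
  avoiding both trees connects the layers and absorbs the remaining length. The minimum
  \<open>2 * h + 3\<close> counts two legs of \<open>h + 1\<close> vertices and a segment of one
  vertex.\<close>

lemma joined_imp_path:
  assumes fin: "\<And>s. finite (W s)" and disj: "W True \<inter> W False = {}" and J: "joined E \<mu> W"
    and X: "expanding E \<mu> W" and big: "\<And>s. 98 * \<mu> \<le> card (W s)" and \<mu>: "1 \<le> \<mu>"
    and h: "\<mu> \<le> 2 ^ h" "2 ^ h \<le> 2 * \<mu>"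
    and ab: "a \<in> W sa" "b \<in> W sb" "a \<noteq> b"
    and l: "2 * h + 3 \<le> l" "l \<le> \<mu>" "even l \<longleftrightarrow> sa \<noteq> sb"
  shows "\<exists>p. gpath E p \<and> set p \<subseteq> W True \<union> W False \<and> p \<noteq> [] \<and> hd p = a \<and> last p = b \<and> length p = l"
proof -
  have "2 ^ h \<le> 4 * \<mu>" using h by simp
  from two_layered[OF X ab this]
  obtain Ta La Tb Lb where T: "layered E a Ta La h" "layered E b Tb Lb h" "Ta \<inter> Tb = {}"
    "La \<subseteq> W (sa = even h)" "Lb \<subseteq> W (sb = even h)" "Ta \<union> Tb \<subseteq> W True \<union> W False" by blast
  define R where "R = (\<lambda>s. W s - (Ta \<union> Tb))"
  have fT: "finite Ta" "finite Tb" "card Ta \<le> 4 * \<mu>" "card Tb \<le> 4 * \<mu>" and cL: "card La = 2 ^ h" "card Lb = 2 ^ h"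
    using T(1,2) h by (auto simp: layered_def)
  have Rsub: "R s \<subseteq> W s" for s by (auto simp: R_def)
  have "90 * \<mu> \<le> card (R s)" for s
  proof -
    have "card (W s) - card (Ta \<union> Tb) \<le> card (R s)"
      unfolding R_def by (rule diff_card_le_card_Diff) (use fT in auto)
    then show ?thesis using big[of s] card_Un_le[of Ta Tb] fT by simp
  qed
  from long_alternating_path[of R, OF _ _ joined_mono[OF J Rsub] this \<mu>]
  obtain q s where q: "gpath E q" "set q \<subseteq> R True \<union> R False" "88 * \<mu> \<le> length q"
    "\<And>i. i < length q \<Longrightarrow> q ! i \<in> R (s = even i)"
    using fin disj by (auto simp: R_def)
  \<comment> \<open>Two legs of \<open>h + 1\<close> vertices and a segment of \<open>d + 1\<close> vertices of \<open>q\<close>.  Almost every vertex on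
    the right side of \<open>q\<close> sees \<open>La\<close>, resp. \<open>Lb\<close>, so some two of them at distance \<open>d\<close> both fit.\<close>
  define d where "d = l - 2 * h - 3"
  \<comment> \<open>The offset puts the positions \<open>x0 + 2 * t\<close> on the side opposite to
    \<open>La\<close>; the parity of \<open>l\<close> then puts those shifted by \<open>d\<close>
    opposite to \<open>Lb\<close>.\<close>
  define x0 where "x0 = (if s = (sa \<noteq> even h) then 0 else 1 :: nat)"
  have d: "l = 2 * h + 3 + d" "d \<le> \<mu>" using l by (auto simp: d_def)
  have side_a: "q ! (x0 + 2 * t) \<in> W (\<not> (sa = even h))" if "t < 2 * \<mu>" for t
  proof -
    have "x0 + 2 * t < length q" using that q(3) \<mu> by (auto simp: x0_def)
    from q(4)[OF this] Rsub have "q ! (x0 + 2 * t) \<in> W (s = even (x0 + 2 * t))" by blast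
    moreover have "W (s = even (x0 + 2 * t)) = W (\<not> (sa = even h))"
      by (rule arg_cong[of _ _ W]) (auto simp: x0_def)
    ultimately show ?thesis by blast
  qed
  have side_b: "q ! (x0 + 2 * t + d) \<in> W (\<not> (sb = even h))" if "t < 2 * \<mu>" for t
  proof -
    have "x0 + 2 * t + d < length q" using that q(3) \<mu> d by (auto simp: x0_def)
    from q(4)[OF this] Rsub have "q ! (x0 + 2 * t + d) \<in> W (s = even (x0 + 2 * t + d))" by blast
    moreover have "even d \<longleftrightarrow> sa = sb" using l(3) d(1) by auto
    then have "W (s = even (x0 + 2 * t + d)) = W (\<not> (sb = even h))"
      by (intro arg_cong[of _ _ W]) (auto simp: x0_def)
    ultimately show ?thesis by blast
  qed
  have few: "card {t. t < 2 * \<mu> \<and> (\<forall>u\<in>L. {u, q ! (y + 2 * t)} \<notin> E)} < \<mu>" (is "card ?B < \<mu>")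
    if L: "L \<subseteq> W c" "card L = 2 ^ h" and y: "y + 4 * \<mu> \<le> length q"
      and sd: "\<And>t. t < 2 * \<mu> \<Longrightarrow> q ! (y + 2 * t) \<in> W (\<not> c)" for L c y
  proof -
    have "inj_on (\<lambda>t. q ! (y + 2 * t)) ?B"
      using q(1) y by (auto simp: inj_on_def gpath_def nth_eq_iff_index_eq)
    then have "card ?B = card ((\<lambda>t. q ! (y + 2 * t)) ` ?B)" by (simp add: card_image)
    also have "\<dots> \<le> card (W (\<not> c) - nb E L (W (\<not> c)))"
      by (intro card_mono) (use sd fin in \<open>auto simp: nb_def\<close>)
    also have "\<dots> < \<mu>" by (rule joined_nonneighbours[OF J L(1)]) (use L h \<mu> in auto)
    finally show ?thesis .
  qed
  define Ba where "Ba = {t. t < 2 * \<mu> \<and> (\<forall>u\<in>La. {u, q ! (x0 + 2 * t)} \<notin> E)}"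
  define Bb where "Bb = {t. t < 2 * \<mu> \<and> (\<forall>u\<in>Lb. {u, q ! (x0 + d + 2 * t)} \<notin> E)}"
  have Ba: "card Ba < \<mu>"
    unfolding Ba_def by (rule few[OF T(4) cL(1) _ side_a]) (use q(3) \<mu> in \<open>auto simp: x0_def\<close>)
  have Bb: "card Bb < \<mu>"
    unfolding Bb_def by (rule few[OF T(5) cL(2)]) (use q(3) \<mu> d side_b in \<open>auto simp: x0_def add_ac\<close>)
  have "\<not> {..<2 * \<mu>} \<subseteq> Ba \<union> Bb"
  proof
    assume "{..<2 * \<mu>} \<subseteq> Ba \<union> Bb"
    then have "card {..<2 * \<mu>} \<le> card (Ba \<union> Bb)"
      by (intro card_mono) (auto simp: Ba_def Bb_def)
    then show False using Ba Bb card_Un_le[of Ba Bb] by simp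
  qed
  then obtain t u v where t: "t < 2 * \<mu>" and u: "u \<in> La" "{u, q ! (x0 + 2 * t)} \<in> E"
    and v: "v \<in> Lb" "{v, q ! (x0 + d + 2 * t)} \<in> E"
    by (auto simp: Ba_def Bb_def)
  obtain pa where pa: "gpath E pa" "pa \<noteq> []" "hd pa = a" "last pa = u" "set pa \<subseteq> Ta" "length pa = Suc h"
    using T(1) u(1) by (auto simp: layered_def)
  obtain pb where pb: "gpath E pb" "pb \<noteq> []" "hd pb = b" "last pb = v" "set pb \<subseteq> Tb" "length pb = Suc h"
    using T(2) v(1) by (auto simp: layered_def)
  define x where "x = x0 + 2 * t"
  have x: "x + d < length q" using t q(3) \<mu> d by (auto simp: x_def x0_def)
  define m where "m = take (Suc d) (drop x q)"
  have m: "length m = Suc d" "m \<noteq> []" "hd m = q ! x" "last m = q ! (x + d)" "gpath E m"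
    "set m \<subseteq> set q"
    using x q(1)
    by (auto simp: m_def hd_drop_conv_nth last_conv_nth gpath_take_drop
        dest!: in_set_takeD in_set_dropD)
  have dT: "set m \<inter> (Ta \<union> Tb) = {}" using m(6) q(2) by (auto simp: R_def)
  have g1: "gpath E (pa @ m)"
    by (rule gpath_append) (use pa m u dT in \<open>auto simp: x_def\<close>)
  have g2: "gpath E ((pa @ m) @ rev pb)"
    by (rule gpath_append[OF g1 gpath_rev[OF pb(1)]])
      (use pa pb m v dT T(3) in \<open>auto simp: x_def hd_rev insert_commute add_ac\<close>)
  have "set ((pa @ m) @ rev pb) \<subseteq> W True \<union> W False"
    using pa(5) pb(5) T(6) m(6) q(2) Rsub[of True] Rsub[of False] by auto
  moreover have "hd ((pa @ m) @ rev pb) = a" "last ((pa @ m) @ rev pb) = b"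
    using pa pb by (auto simp: last_rev)
  moreover have "length ((pa @ m) @ rev pb) = l" using pa pb m d by simp
  ultimately show ?thesis using g2 pa(2) by blast
qed

text \<open>The sides of the cleaned pair serve as labels. Even the shortest length
  \<open>n - t\<close> must hold both legs and one more vertex, hence
  \<open>2 * h + 3 + t \<le> n\<close>.\<close>

lemma joined_imp_linked:
  assumes fin: "\<And>s. finite (W s)" and disj: "W True \<inter> W False = {}" and J: "joined E \<mu> W"
    and big: "\<And>s. 100 * \<mu> \<le> card (W s)"
    and h: "\<mu> \<le> 2 ^ h" "2 ^ h \<le> 2 * \<mu>" and n: "2 * h + 3 + t \<le> n" "n \<le> \<mu>"
  shows "\<exists>Q\<subseteq>W True \<union> W False. linked E n t Q"
proof -
  have \<mu>: "1 \<le> \<mu>" using n by simp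
  obtain W' where W': "\<And>s. W' s \<subseteq> W s" "\<And>s. 98 * \<mu> \<le> card (W' s)" "expanding E \<mu> W'"
    using joined_imp_expanding[OF fin J big \<mu>] by metis
  have fin': "finite (W' s)" for s using W'(1) fin finite_subset by metis
  have disj': "W' True \<inter> W' False = {}" using W'(1) disj by blast
  have J': "joined E \<mu> W'" using joined_mono[OF J] W'(1) by blast
  define Q where "Q = W' True \<union> W' False"
  define sd where "sd = (\<lambda>x. x \<in> W' True)"
  have Qsd: "x \<in> W' (sd x)" if "x \<in> Q" for x using that by (cases "x \<in> W' True") (auto simp: Q_def sd_def)
  have \<mu>W: "\<mu> \<le> card (W' s)" for s using W'(2)[of s] by simp
  have "\<exists>x\<in>W' True. \<exists>y\<in>W' False. {x, y} \<in> E"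
    using J'[unfolded joined_def, rule_format, of "W' True" True "W' False"] \<mu>W by simp
  then have "\<exists>a\<in>Q. \<exists>b\<in>Q. {a, b} \<in> E \<and> sd a \<noteq> sd b"
    using disj' by (auto simp: Q_def sd_def)
  moreover have "exact_paths E n t Q sd"
    unfolding exact_paths_def
  proof (intro ballI allI impI)
    fix a b l
    assume that: "a \<in> Q" "b \<in> Q" "a \<noteq> b" "n \<le> l + t" "l \<le> n" "even l = (sd a \<noteq> sd b)"
    show "\<exists>p. gpath E p \<and> set p \<subseteq> Q \<and> p \<noteq> [] \<and> hd p = a \<and> last p = b \<and> length p = l"
      unfolding Q_def
      by (rule joined_imp_path[OF fin' disj' J' W'(3) W'(2) \<mu> h Qsd[OF that(1)] Qsd[OF that(2)] that(3)])
        (use that n in linarith, use that n in linarith, use that in simp)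
  qed
  moreover have "n \<le> card Q"
    using \<mu>W[of True] n(2) card_mono[of Q "W' True"] fin' by (auto simp: Q_def)
  moreover have "finite Q" using fin' by (simp add: Q_def)
  ultimately have "linked E n t Q"
    by (intro linkedI)
  moreover have "Q \<subseteq> W True \<union> W False" using W'(1) by (auto simp: Q_def)
  ultimately show ?thesis by blast
qed

lemma linked_even_cycle:
  assumes "linked E n t Q" "even n" "Q \<subseteq> V"
  shows "contains_copy \<lparr>uverts = V, uedges = E\<rparr> (cycle_graph n)"
proof -
  obtain sd a b where sd: "exact_paths E n t Q sd" and ab: "a \<in> Q" "b \<in> Q" "{a, b} \<in> E" "sd a \<noteq> sd b"
    using assms(1) unfolding linked_def by blast
  then have "a \<noteq> b" by auto
  then obtain p where "gpath E p" "set p \<subseteq> Q" "p \<noteq> []" "hd p = a" "last p = b" "length p = n"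
    using exact_pathsD[OF sd ab(1,2), of n] ab assms(2) by auto
  then show ?thesis
    using contains_cycle[of E p V] assms(3) ab(3) by (auto simp: insert_commute)
qed

text \<open>Linked sets are connected: one of the lengths \<open>n\<close> and \<open>n - 1\<close>
  has the right parity, and \<open>1 \<le> t\<close> admits both, so a path inside \<open>Q\<close>
  leaves \<open>Z\<close>.\<close>

lemma linked_crossing:
  assumes "linked E n t Q" "1 \<le> t" "Z \<subseteq> Q" "Z \<noteq> {}" "Z \<noteq> Q" "1 \<le> n"
  shows "\<exists>x\<in>Z. \<exists>y\<in>Q - Z. {x, y} \<in> E"
proof -
  obtain sd where sd: "exact_paths E n t Q sd"
    using assms(1) unfolding linked_def by blast
  obtain a b where ab: "a \<in> Z" "b \<in> Q" "b \<notin> Z" using assms(3-5) by blast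
  define l where "l = (if even n = (sd a \<noteq> sd b) then n else n - 1)"
  have "n \<le> l + t" "l \<le> n" "even l = (sd a \<noteq> sd b)"
    using assms(2,6) by (auto simp: l_def)
  then obtain p where p: "gpath E p" "set p \<subseteq> Q" "p \<noteq> []" "hd p = a" "last p = b"
    using exact_pathsD[OF sd, of a b l] ab assms(3) by blast
  have "\<exists>x\<in>set p \<inter> Z. \<exists>y\<in>set p - Z. {x, y} \<in> E"
    using p ab by (intro successively_crossing) (auto simp: gpath_def)
  then show ?thesis using p(2) by blast
qed

section \<open>Growing trees from a linked set\<close>

text \<open>
  Each \<open>v \<in> S\<close> hangs by the path \<open>\<pi> v\<close> on its root \<open>\<rho> v \<in> Q\<close>; the fibres of \<open>\<rho>\<close> are the trees.
\<close>

definition sprout ::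
  "'a set set \<Rightarrow> 'a set \<Rightarrow> 'a set \<Rightarrow> nat \<Rightarrow> 'a set \<Rightarrow> ('a \<Rightarrow> 'a) \<Rightarrow> ('a \<Rightarrow> 'a list) \<Rightarrow> bool" where
  "sprout E Q U j S \<rho> \<pi> \<longleftrightarrow> Q \<subseteq> S \<and> S \<subseteq> U \<and>
     (\<forall>q\<in>Q. \<rho> q = q \<and> card {v \<in> S. \<rho> v = q} \<le> 2 ^ j) \<and>
     (\<forall>v\<in>S. \<rho> v \<in> Q \<and> gpath E (\<pi> v) \<and> \<pi> v \<noteq> [] \<and> hd (\<pi> v) = v \<and> last (\<pi> v) = \<rho> v \<and>
        set (\<pi> v) \<subseteq> {w \<in> S. \<rho> w = \<rho> v} \<and> length (\<pi> v) \<le> Suc j)"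

text \<open>\<open>C\<close> is meant to be the vertex set of a maximum matching between
  \<open>S\<close> and \<open>U - S\<close> that is too small to continue the growth: it covers all
  edges leaving \<open>S\<close> within \<open>U\<close>.\<close>

definition closed_off :: "'a set set \<Rightarrow> 'a set \<Rightarrow> 'a set \<Rightarrow> 'a set \<Rightarrow> bool" where
  "closed_off E U S C \<longleftrightarrow> C \<subseteq> U \<and> 2 * card (S \<union> C) \<le> 3 * card S \<and> 2 * card (C \<inter> S) \<le> card S \<and>
     (\<forall>x\<in>S - C. \<forall>y\<in>U - S - C. {x, y} \<notin> E)"

lemma sprout_mono: "sprout E Q U j S \<rho> \<pi> \<Longrightarrow> j \<le> r \<Longrightarrow> sprout E Q U r S \<rho> \<pi>"
  unfolding sprout_def
  using power_increasing[of j r "2 :: nat"] by (meson Suc_le_mono le_trans one_le_numeral)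

text \<open>Take a largest set \<open>X\<close> outside \<open>S\<close> that is matched into
  \<open>S\<close>. If it has at least half the size of \<open>S\<close>, hanging each vertex on its
  partner gives the next stage; otherwise the matched vertices on both sides close off
  \<open>S\<close>.\<close>

lemma sprout_step:
  assumes finU: "finite U" and sp: "sprout E Q U j S \<rho> \<pi>"
  shows "(\<exists>C. closed_off E U S C) \<or>
    (\<exists>S' \<rho>' \<pi>'. sprout E Q U (Suc j) S' \<rho>' \<pi>' \<and> 3 * card S \<le> 2 * card S')"
proof -
  define P where "P = (\<lambda>X. X \<subseteq> U - S \<and> (\<exists>f. inj_on f X \<and> f ` X \<subseteq> S \<and> (\<forall>x\<in>X. {x, f x} \<in> E)))"
  have "P {}" by (auto simp: P_def)
  moreover have "\<forall>X. P X \<longrightarrow> card X < Suc (card U)"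
    by (auto simp: P_def less_Suc_eq_le intro!: card_mono finU)
  ultimately obtain X where "P X" and Xmax: "\<And>X'. P X' \<Longrightarrow> card X' \<le> card X"
    using ex_has_greatest_nat[of P "{}" card "Suc (card U)"] by blast
  then obtain f where X: "X \<subseteq> U - S" and f: "inj_on f X" "f ` X \<subseteq> S" "\<And>x. x \<in> X \<Longrightarrow> {x, f x} \<in> E"
    by (auto simp: P_def)
  have SU: "S \<subseteq> U" using sp by (simp add: sprout_def)
  have finS: "finite S" using SU finU by (rule finite_subset)
  have finX: "finite X" using X finU by (meson finite_Diff finite_subset)
  have cSX: "card (S \<union> X) = card S + card X" using X finS finX by (subst card_Un_disjoint) auto
  show ?thesis
  proof (cases "card S \<le> 2 * card X")
    case False
    \<comment> \<open>An uncovered edge would enlarge the matching.\<close>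
    have "{x, y} \<notin> E" if xy: "x \<in> S - (X \<union> f ` X)" "y \<in> U - S - (X \<union> f ` X)" for x y
    proof
      assume "{x, y} \<in> E"
      then have "P (insert y X)"
        unfolding P_def using X f xy
        by (intro conjI exI[of _ "f(y := x)"]) (auto simp: inj_on_def insert_commute)
      then show False using Xmax[of "insert y X"] xy finX by auto
    qed
    moreover have "S \<union> (X \<union> f ` X) = S \<union> X" "(X \<union> f ` X) \<inter> S = f ` X" using X f(2) by auto
    ultimately have "closed_off E U S (X \<union> f ` X)"
      using False cSX X f SU by (auto simp: closed_off_def card_image)
    then show ?thesis by blast
  next
    case True
    define \<rho>' where "\<rho>' = (\<lambda>v. if v \<in> X then \<rho> (f v) else \<rho> v)"
    define \<pi>' where "\<pi>' = (\<lambda>v. if v \<in> X then v # \<pi> (f v) else \<pi> v)"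
    have XS: "v \<notin> X" if "v \<in> S" for v using that X by auto
    have QS: "Q \<subseteq> S" using sp by (simp add: sprout_def)
    have "card {v \<in> S \<union> X. \<rho>' v = q} \<le> 2 ^ Suc j" if q: "q \<in> Q" for q
    proof -
      let ?F = "{v \<in> S. \<rho> v = q}"
      have F: "card ?F \<le> 2 ^ j" using sp q by (simp add: sprout_def)
      \<comment> \<open>By injectivity of \<open>f\<close> a tree at most doubles.\<close>
      have "card {x \<in> X. f x \<in> ?F} \<le> card ?F"
        by (rule card_inj_on_le[of f]) (use f(1) finS in \<open>auto intro: inj_on_subset\<close>)
      moreover have "{v \<in> S \<union> X. \<rho>' v = q} \<subseteq> ?F \<union> {x \<in> X. f x \<in> ?F}"
        using f(2) by (auto simp: \<rho>'_def split: if_splits)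
      then have "card {v \<in> S \<union> X. \<rho>' v = q} \<le> card (?F \<union> {x \<in> X. f x \<in> ?F})"
        by (rule card_mono[rotated]) (use finS finX in auto)
      ultimately show ?thesis using F card_Un_le[of ?F "{x \<in> X. f x \<in> ?F}"] by simp
    qed
    moreover have "\<rho>' q = q" if "q \<in> Q" for q
      using that sp XS QS by (auto simp: \<rho>'_def sprout_def)
    moreover have "\<rho>' v \<in> Q \<and> gpath E (\<pi>' v) \<and> \<pi>' v \<noteq> [] \<and> hd (\<pi>' v) = v \<and> last (\<pi>' v) = \<rho>' v \<and>
        set (\<pi>' v) \<subseteq> {w \<in> S \<union> X. \<rho>' w = \<rho>' v} \<and> length (\<pi>' v) \<le> Suc (Suc j)"
      if v: "v \<in> S \<union> X" for v
    proof -
      define u where "u = (if v \<in> X then f v else v)"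
      have "u \<in> S" using v f(2) by (auto simp: u_def)
      then have u: "\<rho> u \<in> Q" "gpath E (\<pi> u)" "\<pi> u \<noteq> []" "hd (\<pi> u) = u" "last (\<pi> u) = \<rho> u"
        "set (\<pi> u) \<subseteq> {w \<in> S. \<rho> w = \<rho> u}" "length (\<pi> u) \<le> Suc j"
        using sp unfolding sprout_def by blast+
      have sub: "set (\<pi> u) \<subseteq> {w \<in> S \<union> X. \<rho>' w = \<rho> u}"
        using u(6) XS by (auto simp: \<rho>'_def)
      have \<rho>v: "\<rho>' v = \<rho> u" by (simp add: \<rho>'_def u_def)
      show ?thesis
      proof (cases "v \<in> X")
        case True
        then have \<pi>v: "\<pi>' v = v # \<pi> u" and uf: "u = f v" by (auto simp: \<pi>'_def u_def)
        have "v \<notin> set (\<pi> u)" using u(6) True X by auto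
        moreover have "{v, u} \<in> E" using f(3) True uf by simp
        ultimately show ?thesis
          unfolding \<rho>v \<pi>v using u sub True \<rho>v by (auto simp: gpath_def successively_Cons)
      next
        case False
        then have "\<pi>' v = \<pi> u" "u = v" by (auto simp: \<pi>'_def u_def)
        then show ?thesis unfolding \<rho>v using u sub by auto
      qed
    qed
    ultimately have "sprout E Q U (Suc j) (S \<union> X) \<rho>' \<pi>'"
      unfolding sprout_def using QS SU X by auto
    moreover have "3 * card S \<le> 2 * card (S \<union> X)" using True cSX by simp
    ultimately show ?thesis by blast
  qed
qed

text \<open>Without closing off, every round multiplies \<open>card S\<close> by at least 3/2; after
  \<open>r\<close> rounds \<open>S\<close> would outgrow \<open>U\<close>.\<close>

lemma sprout_closed_off:
  assumes finU: "finite U" and Q: "Q \<subseteq> U" "Q \<noteq> {}" and small: "card U \<le> \<Lambda> * card Q"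
    and r: "2 ^ r * \<Lambda> < (3 :: nat) ^ r"
  shows "\<exists>S \<rho> \<pi> C. sprout E Q U r S \<rho> \<pi> \<and> closed_off E U S C"
proof (rule ccontr)
  assume neg: "\<not> ?thesis"
  have iter: "\<exists>S \<rho> \<pi>. sprout E Q U j S \<rho> \<pi> \<and> 3 ^ j * card Q \<le> 2 ^ j * card S" if "j \<le> r" for j
    using that
  proof (induction j)
    case 0
    have "{v. v \<in> Q \<and> v = q} = {q}" if "q \<in> Q" for q using that by auto
    then have "sprout E Q U 0 Q (\<lambda>v. v) (\<lambda>v. [v])"
      using Q by (auto simp: sprout_def gpath_def)
    then show ?case by auto
  next
    case (Suc j)
    then obtain S \<rho> \<pi> where S: "sprout E Q U j S \<rho> \<pi>" "3 ^ j * card Q \<le> 2 ^ j * card S" by auto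
    have "\<not> (\<exists>C. closed_off E U S C)"
      using neg sprout_mono[OF S(1), of r] Suc.prems by auto
    then obtain S' \<rho>' \<pi>' where S': "sprout E Q U (Suc j) S' \<rho>' \<pi>'" "3 * card S \<le> 2 * card S'"
      using sprout_step[OF finU S(1)] by blast
    have "3 ^ Suc j * card Q \<le> 2 ^ j * (3 * card S)" using S(2) by simp
    also have "\<dots> \<le> 2 ^ Suc j * card S'" using S'(2) by simp
    finally show ?case using S'(1) by blast
  qed
  from iter[OF order_refl]
  obtain S \<rho> \<pi> where S: "sprout E Q U r S \<rho> \<pi>" "3 ^ r * card Q \<le> 2 ^ r * card S" by blast
  have "card S \<le> card U" using S(1) finU by (auto simp: sprout_def intro: card_mono)
  then have "3 ^ r * card Q \<le> (2 ^ r * \<Lambda>) * card Q"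
    using S(2) small by (metis (no_types, lifting) mult.assoc mult_le_mono2 order_trans)
  moreover have "card Q > 0" using Q finU by (meson card_gt_0_iff finite_subset)
  ultimately show False using r by auto
qed

text \<open>The cycle runs from \<open>u\<close> to its root, through \<open>Q\<close> by an exact
  path to the root of \<open>v\<close>, up to \<open>v\<close>, and back along the edge. Equal
  labels of \<open>u\<close> and \<open>v\<close> give the middle path the parity it needs for odd
  \<open>n\<close>.\<close>

lemma sprout_odd_cycle:
  assumes sp: "sprout E Q U r S \<rho> \<pi>" and "odd n" "2 * r \<le> n" "U \<subseteq> V"
    and sd: "exact_paths E n (2 * r) Q sd"
    and uv: "u \<in> S" "v \<in> S" "{u, v} \<in> E" "\<rho> u \<noteq> \<rho> v"
      "(sd (\<rho> u) = odd (length (\<pi> u))) = (sd (\<rho> v) = odd (length (\<pi> v)))"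
  shows "contains_copy \<lparr>uverts = V, uedges = E\<rparr> (cycle_graph n)"
proof -
  have pr: "\<rho> w \<in> Q \<and> gpath E (\<pi> w) \<and> \<pi> w \<noteq> [] \<and> hd (\<pi> w) = w \<and> last (\<pi> w) = \<rho> w \<and>
        set (\<pi> w) \<subseteq> {x \<in> S. \<rho> x = \<rho> w} \<and> length (\<pi> w) \<le> Suc r" if "w \<in> S" for w
    using sp that unfolding sprout_def by blast
  have onQ: "\<rho> q = q" "q \<in> S" if "q \<in> Q" for q using sp that by (auto simp: sprout_def)
  have SV: "S \<subseteq> V" using sp assms(4) by (auto simp: sprout_def)
  \<comment> \<open>The roots belong to the middle path, so \<open>p\<close> and \<open>q\<close>
    omit them and have at most \<open>r\<close> vertices each; this is the slack
    \<open>2 * r\<close>.\<close>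
  obtain p where p: "\<pi> u = p @ [\<rho> u]" using pr[OF uv(1)] by (metis append_butlast_last_id)
  obtain q where q: "\<pi> v = q @ [\<rho> v]" using pr[OF uv(2)] by (metis append_butlast_last_id)
  have lp: "length p \<le> r" "length q \<le> r" using pr[OF uv(1)] pr[OF uv(2)] p q by auto
  define l where "l = n - (length p + length q)"
  have l: "n \<le> l + 2 * r" "l \<le> n" "l + (length p + length q) = n" using lp assms(3) by (auto simp: l_def)
  have "even l = (sd (\<rho> u) \<noteq> sd (\<rho> v))"
    using uv(5) \<open>odd n\<close> l(3) by (auto simp: p q)
  then obtain m where m: "gpath E m" "set m \<subseteq> Q" "m \<noteq> []" "hd m = \<rho> u" "last m = \<rho> v" "length m = l"
    using exact_pathsD[OF sd, of "\<rho> u" "\<rho> v" l] pr uv l by blast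
  have sets: "set p \<subseteq> {x \<in> S. \<rho> x = \<rho> u}" "set q \<subseteq> {x \<in> S. \<rho> x = \<rho> v}" "\<rho> u \<notin> set p" "\<rho> v \<notin> set q"
    using pr[OF uv(1)] pr[OF uv(2)] p q by (auto simp: gpath_def)
  \<comment> \<open>A vertex of \<open>Q\<close> is its own root, so each tree meets
    \<open>Q\<close> only in its root.\<close>
  have notQ: "set p \<inter> Q = {}" "set q \<inter> Q = {}" using sets onQ by fastforce+
  have g: "successively (\<lambda>x y. {x, y} \<in> E) (p @ [\<rho> u])" "successively (\<lambda>x y. {x, y} \<in> E) (q @ [\<rho> v])"
    "distinct p" "distinct q"
    using pr[OF uv(1)] pr[OF uv(2)] p q by (auto simp: gpath_def)
  define c where "c = p @ m @ rev q"
  have "set p \<inter> set q = {}" using sets(1,2) uv(4) by fastforce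
  then have "distinct c"
    unfolding c_def using g m notQ by (auto simp: gpath_def)
  moreover have "successively (\<lambda>x y. {x, y} \<in> E) c"
    unfolding c_def using g m
    by (auto simp: successively_append_iff gpath_def hd_rev insert_commute)
  ultimately have gc: "gpath E c" by (simp add: gpath_def)
  have "hd c = u" using pr[OF uv(1)] p m by (cases p) (auto simp: c_def)
  moreover have "last c = v" using pr[OF uv(2)] q m by (cases q) (auto simp: c_def)
  ultimately have "{last c, hd c} \<in> E" using uv(3) by (simp add: insert_commute)
  moreover have "set c \<subseteq> V" using sets(1,2) m(2) onQ(2) SV unfolding c_def by fastforce
  moreover have "c \<noteq> []" using m(3) by (simp add: c_def)
  moreover have "length c = n" using m(6) l(3) by (simp add: c_def)
  ultimately show ?thesis using contains_cycle[OF gc] by blast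
qed

section \<open>Destroying all linked sets of one colour\<close>

text \<open>Peel off \<open>S \<union> C\<close> around a linked set, keep a part \<open>X\<close>
  of it, and recurse on the rest. Edges between kept vertices of \<open>S\<close> stay within trees,
  and none lead from them to the rest, so a linked set meeting \<open>X\<close> would be confined to
  one tree, which has fewer than \<open>n\<close> vertices.\<close>

lemma colour_step:
  assumes finV: "finite V" and nocyc: "\<not> contains_copy \<lparr>uverts = V, uedges = E\<rparr> (cycle_graph n)"
    and n: "2 ^ r < n" "2 * r \<le> n" "1 \<le> r" and V: "card V \<le> \<Lambda> * n" and r: "2 ^ r * \<Lambda> < (3 :: nat) ^ r"
    and U: "U \<subseteq> V"
  shows "\<exists>U'\<subseteq>U. card U \<le> 6 * card U' \<and> (\<forall>Q\<subseteq>U'. \<not> linked E n (2 * r) Q)"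
  using U
proof (induction "card U" arbitrary: U rule: less_induct)
  case less
  have finU: "finite U" using less.prems finV by (rule finite_subset)
  show ?case
  proof (cases "\<exists>Q\<subseteq>U. linked E n (2 * r) Q")
    case False
    then show ?thesis by (intro exI[of _ U]) auto
  next
    case True
    then obtain Q where Q: "Q \<subseteq> U" "linked E n (2 * r) Q" by blast
    then have "odd n" using linked_even_cycle nocyc less.prems by (metis order_trans)
    have "n \<le> card Q" using Q(2) by (simp add: linked_def)
    then have Q0: "Q \<noteq> {}" using n by auto
    have "card U \<le> \<Lambda> * card Q"
      using card_mono[OF finV less.prems] V \<open>n \<le> card Q\<close> by (meson mult_le_mono2 order_trans)
    from sprout_closed_off[OF finU Q(1) Q0 this r, of E]
    obtain S \<rho> \<pi> C where sp: "sprout E Q U r S \<rho> \<pi>" and C: "closed_off E U S C" by blast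
    have SU: "S \<subseteq> U" "Q \<subseteq> S" using sp by (auto simp: sprout_def)
    have finS: "finite S" using SU(1) finU by (rule finite_subset)
    have CU: "C \<subseteq> U" using C by (simp add: closed_off_def)
    obtain sd where sd: "exact_paths E n (2 * r) Q sd"
      using Q(2) unfolding linked_def by blast
    \<comment> \<open>the bipartition of \<open>Q\<close>, extended along the trees\<close>
    define lab where "lab = (\<lambda>v. sd (\<rho> v) = odd (length (\<pi> v)))"
    have proper: "lab u \<noteq> lab v" if "u \<in> S" "v \<in> S" "{u, v} \<in> E" "\<rho> u \<noteq> \<rho> v" for u v
      using sprout_odd_cycle[OF sp \<open>odd n\<close> n(2) less.prems sd that] nocyc unfolding lab_def by blast
    \<comment> \<open>Edges between different trees join different labels; keeping only the more
      frequent label removes them.\<close>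
    define cls where "cls = (\<lambda>c. {v \<in> S - C. lab v = c})"
    have "card (S - C) = card (cls True \<union> cls False)"
      by (rule arg_cong[of _ _ card]) (auto simp: cls_def)
    also have "\<dots> \<le> card (cls True) + card (cls False)" by (rule card_Un_le)
    finally obtain c where c: "card (S - C) \<le> 2 * card (cls c)"
      by (cases "card (cls True) \<le> card (cls False)") (auto intro: that[of True] that[of False])
    define X where "X = cls c"
    have "card (S - C) = card S - card (C \<inter> S)"
      using card_Diff_subset_Int[of S C] finS by (simp add: Int_commute)
    moreover have "2 * card (C \<inter> S) \<le> card S" using C by (simp add: closed_off_def)
    ultimately have X: "card S \<le> 4 * card X" using c unfolding X_def by linarith
    define U1 where "U1 = U - (S \<union> C)"
    have "card U = card U1 + card (S \<union> C)"
      unfolding U1_def using SU CU finU by (metis card_Diff_subset card_mono finite_subset le_add_diff_inverse2 Un_least)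
    moreover have "card (S \<union> C) > 0"
      using Q0 SU CU finU by (metis card_gt_0_iff finite_subset Un_least Un_empty subset_empty)
    ultimately have cU: "card U = card U1 + card (S \<union> C)" "card U1 < card U" by auto
    have "U1 \<subseteq> V" using less.prems by (auto simp: U1_def)
    from less.hyps[OF cU(2) this]
    obtain U1' where U1': "U1' \<subseteq> U1" "card U1 \<le> 6 * card U1'" "\<And>P. P \<subseteq> U1' \<Longrightarrow> \<not> linked E n (2 * r) P"
      by blast
    have finX: "finite X" "finite U1'"
      using finS U1'(1) finU by (auto simp: X_def cls_def U1_def intro: finite_subset)
    have "U1' \<inter> X = {}" using U1'(1) by (auto simp: X_def cls_def U1_def)
    then have "card (U1' \<union> X) = card U1' + card X" using finX by (simp add: card_Un_disjoint)
    \<comment> \<open>\<open>X\<close> has at least a quarter of \<open>S\<close>, and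
      \<open>S \<union> C\<close> at most 3/2 of it: the loss is 4 * 3/2 = 6.\<close>
    then have "card U \<le> 6 * card (U1' \<union> X)" using cU(1) U1'(2) X C by (simp add: closed_off_def)
    moreover have "U1' \<union> X \<subseteq> U" using U1'(1) SU by (auto simp: U1_def X_def cls_def)
    moreover have "\<not> linked E n (2 * r) P" if P: "P \<subseteq> U1' \<union> X" for P
    proof
      assume lP: "linked E n (2 * r) P"
      then have "\<not> P \<subseteq> U1'" using U1'(3) by blast
      then obtain x where x: "x \<in> P" "x \<in> X" using P by blast
      then have xS: "x \<in> S" by (simp add: X_def cls_def)
      then have "\<rho> x \<in> Q" using sp by (simp add: sprout_def)
      then have "card {w \<in> S. \<rho> w = \<rho> x} \<le> 2 ^ r" using sp unfolding sprout_def by blast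
      \<comment> \<open>The part of \<open>P\<close> in the tree of \<open>x\<close>; being smaller
        than \<open>P\<close>, it must be left by an edge inside \<open>P\<close>.\<close>
      moreover define Z where "Z = {w \<in> P \<inter> X. \<rho> w = \<rho> x}"
      have "Z \<subseteq> {w \<in> S. \<rho> w = \<rho> x}" by (auto simp: Z_def X_def cls_def)
      then have "card Z \<le> card {w \<in> S. \<rho> w = \<rho> x}" using finS by (intro card_mono) auto
      moreover have "n \<le> card P" using lP by (simp add: linked_def)
      ultimately have "Z \<noteq> P" using n by auto
      moreover have "Z \<subseteq> P" "Z \<noteq> {}" using x by (auto simp: Z_def)
      ultimately obtain y z where yz: "z \<in> Z" "y \<in> P - Z" "{z, y} \<in> E"
        using linked_crossing[OF lP, of Z] n by auto
      have z: "z \<in> S - C" "lab z = c" "\<rho> z = \<rho> x" using yz(1) by (auto simp: Z_def X_def cls_def)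
      show False
      proof (cases "y \<in> X")
        case True
        then have "y \<in> S" "lab y = c" "\<rho> y \<noteq> \<rho> x" using yz(2) by (auto simp: Z_def X_def cls_def)
        then show False using proper[of z y] z yz(3) by auto
      next
        case False
        then have "y \<in> U - S - C" using yz(2) P U1'(1) by (auto simp: U1_def)
        then show False using C z(1) yz(3) by (auto simp: closed_off_def)
      qed
    qed
    ultimately show ?thesis by blast
  qed
qed

section \<open>Finding a linked set in some colour\<close>

text \<open>If the top colour is not joined at scale \<open>100 ^ j * n\<close>, two subsets of that
  size avoid it, and the induction continues with one colour fewer. With no colour left, the edge
  supplied by the host is a contradiction.\<close>

lemma joined_colour_pair:
  fixes \<chi> :: "'a set \<Rightarrow> nat"
  assumes host: "\<And>X Y. X \<subseteq> V \<Longrightarrow> Y \<subseteq> V \<Longrightarrow> X \<inter> Y = {} \<Longrightarrow> n \<le> card X \<Longrightarrow> n \<le> card Y \<Longrightarrow>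
      \<exists>x\<in>X. \<exists>y\<in>Y. {x, y} \<in> E"
    and "A \<subseteq> V" "B \<subseteq> V" "A \<inter> B = {}" "100 ^ j * n \<le> card A" "100 ^ j * n \<le> card B"
    and "\<And>x y. x \<in> A \<Longrightarrow> y \<in> B \<Longrightarrow> {x, y} \<in> E \<Longrightarrow> \<chi> {x, y} < j"
  shows "\<exists>i m W. i < j \<and> m < j \<and> W True \<subseteq> A \<and> W False \<subseteq> B \<and>
    joined {e \<in> E. \<chi> e = i} (100 ^ m * n) W \<and> (\<forall>s. 100 * (100 ^ m * n) \<le> card (W s))"
  using assms(2-)
proof (induction j arbitrary: A B)
  case 0
  then show ?case using host[of A B] by auto
next
  case (Suc j)
  let ?W = "\<lambda>s. if s then A else B" and ?E = "{e \<in> E. \<chi> e = j}"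
  show ?case
  proof (cases "joined ?E (100 ^ j * n) ?W")
    case True
    with Suc.prems show ?thesis
      by - (rule exI[of _ j], rule exI[of _ j], rule exI[of _ ?W], simp)
  next
    case False
    then have "\<exists>s X Y. X \<subseteq> ?W s \<and> Y \<subseteq> ?W (\<not> s) \<and> 100 ^ j * n \<le> card X \<and> 100 ^ j * n \<le> card Y \<and>
        \<not> (\<exists>x\<in>X. \<exists>y\<in>Y. {x, y} \<in> ?E)"
      unfolding joined_def by (simp only: not_all not_imp conj_assoc)
    then obtain s X Y where XY: "X \<subseteq> ?W s" "Y \<subseteq> ?W (\<not> s)" "100 ^ j * n \<le> card X" "100 ^ j * n \<le> card Y"
      and "\<not> (\<exists>x\<in>X. \<exists>y\<in>Y. {x, y} \<in> ?E)"
      by (elim exE conjE)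
    then have noE: "{x, y} \<notin> ?E" if "x \<in> X" "y \<in> Y" for x y using that by blast
    \<comment> \<open>The failing subsets may come in either order; this restores the orientation of
      \<open>A\<close> and \<open>B\<close>.\<close>
    define A' B' where "A' = (if s then X else Y)" and "B' = (if s then Y else X)"
    have sub: "A' \<subseteq> A" "B' \<subseteq> B" and c: "100 ^ j * n \<le> card A'" "100 ^ j * n \<le> card B'"
      using XY by (auto simp: A'_def B'_def split: if_splits)
    have "\<chi> {x, y} < j" if "x \<in> A'" "y \<in> B'" "{x, y} \<in> E" for x y
    proof -
      have "{x, y} \<notin> ?E"
        using that noE[of x y] noE[of y x] by (auto simp: A'_def B'_def insert_commute split: if_splits)
      moreover have "\<chi> {x, y} < Suc j" using that sub by (intro Suc.prems) auto
      ultimately show ?thesis using that(3) by auto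
    qed
    with sub c Suc.prems(1-3) have "\<exists>i m W. i < j \<and> m < j \<and> W True \<subseteq> A' \<and> W False \<subseteq> B' \<and>
        joined {e \<in> E. \<chi> e = i} (100 ^ m * n) W \<and> (\<forall>s. 100 * (100 ^ m * n) \<le> card (W s))"
      by (intro Suc.IH) auto
    then obtain i m W where W: "i < j" "m < j" "W True \<subseteq> A'" "W False \<subseteq> B'"
      "joined {e \<in> E. \<chi> e = i} (100 ^ m * n) W" "\<forall>s. 100 * (100 ^ m * n) \<le> card (W s)"
      by (elim exE conjE)
    note order_trans[OF W(3) sub(1)] order_trans[OF W(4) sub(2)]
    with W show ?thesis
      by - (rule exI[of _ i], rule exI[of _ m], rule exI[of _ W], simp)
  qed
qed

text \<open>In \<open>2 * 600 ^ k\<close>, each colour pays 6 for the removal of its linked sets and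
  100 for the shrinking in \<open>joined_colour_pair\<close>; the 2 pays for splitting what remains
  into two sides.\<close>

lemma joined_host_ramsey:
  fixes E :: "nat set set"
  assumes finV: "finite V" and cV: "card V = 2 * 600 ^ k * n"
    and host: "\<And>X Y. X \<subseteq> V \<Longrightarrow> Y \<subseteq> V \<Longrightarrow> X \<inter> Y = {} \<Longrightarrow> n \<le> card X \<Longrightarrow> n \<le> card Y \<Longrightarrow>
      \<exists>x\<in>X. \<exists>y\<in>Y. {x, y} \<in> E"
    and r: "2 ^ r * (2 * 600 ^ k) < (3 :: nat) ^ r" "1 \<le> r" and n: "2 ^ r < n" "2 * r \<le> n"
    and h: "\<And>\<mu>. n \<le> \<mu> \<Longrightarrow> \<mu> \<le> 100 ^ k * n \<Longrightarrow>
      \<exists>h. \<mu> \<le> 2 ^ h \<and> 2 ^ h \<le> 2 * \<mu> \<and> 2 * h + 3 + 2 * r \<le> n"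
  shows "ramsey_for k \<lparr>uverts = V, uedges = E\<rparr> (cycle_graph n)"
  unfolding ramsey_for_def
proof (intro allI impI, rule ccontr)
  fix \<chi> :: "nat set \<Rightarrow> nat"
  assume \<chi>: "\<chi> ` uedges \<lparr>uverts = V, uedges = E\<rparr> \<subseteq> {..<k}"
  assume "\<not> (\<exists>i<k. contains_copy (colour_class \<lparr>uverts = V, uedges = E\<rparr> \<chi> i) (cycle_graph n))"
  then have nocyc: "\<not> contains_copy \<lparr>uverts = V, uedges = {e \<in> E. \<chi> e = i}\<rparr> (cycle_graph n)"
    if "i < k" for i using that by (auto simp: colour_class_def)
  have iter: "\<exists>U\<subseteq>V. card V \<le> 6 ^ j * card U \<and> (\<forall>i<j. \<forall>Q\<subseteq>U. \<not> linked {e \<in> E. \<chi> e = i} n (2 * r) Q)"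
    if "j \<le> k" for j
    using that
  proof (induction j)
    case 0
    show ?case by (intro exI[of _ V]) auto
  next
    case (Suc j)
    then obtain U where U: "U \<subseteq> V" "card V \<le> 6 ^ j * card U"
      "\<And>i Q. i < j \<Longrightarrow> Q \<subseteq> U \<Longrightarrow> \<not> linked {e \<in> E. \<chi> e = i} n (2 * r) Q" by auto
    obtain U' where U': "U' \<subseteq> U" "card U \<le> 6 * card U'"
      "\<And>Q. Q \<subseteq> U' \<Longrightarrow> \<not> linked {e \<in> E. \<chi> e = j} n (2 * r) Q"
      using colour_step[OF finV nocyc n r(2) _ r(1) U(1), of j] Suc.prems cV by auto
    have "card V \<le> 6 ^ j * (6 * card U')" using U(2) U'(2) by (meson mult_le_mono2 order_trans)
    then have "card V \<le> 6 ^ Suc j * card U'" by (simp add: mult_ac)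
    moreover have "\<not> linked {e \<in> E. \<chi> e = i} n (2 * r) Q" if "i < Suc j" "Q \<subseteq> U'" for i Q
    proof (cases "i = j")
      case True
      then show ?thesis using U'(3) that(2) by simp
    next
      case False
      then show ?thesis using U(3)[of i Q] that U'(1) by simp
    qed
    moreover have "U' \<subseteq> V" using U'(1) U(1) by (rule order_trans)
    ultimately show ?case by blast
  qed
  from iter[OF order_refl] obtain U where U: "U \<subseteq> V" "card V \<le> 6 ^ k * card U"
    "\<And>i Q. i < k \<Longrightarrow> Q \<subseteq> U \<Longrightarrow> \<not> linked {e \<in> E. \<chi> e = i} n (2 * r) Q" by blast
  have "(600 :: nat) ^ k = 6 ^ k * 100 ^ k" by (simp flip: power_mult_distrib)
  with U(2) have "6 ^ k * (2 * (100 ^ k * n)) \<le> 6 ^ k * card U" unfolding cV by (simp add: mult_ac)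
  then have cU: "2 * (100 ^ k * n) \<le> card U" by simp
  then obtain A where A: "A \<subseteq> U" "card A = 100 ^ k * n"
    using obtain_subset_with_card_n[of "100 ^ k * n" U] by auto
  have finU: "finite U" using U(1) finV by (rule finite_subset)
  have B: "100 ^ k * n \<le> card (U - A)"
    using A cU finU by (subst card_Diff_subset) (auto intro: finite_subset)
  have "\<chi> {x, y} < k" if "{x, y} \<in> E" for x y using that \<chi> by auto
  with host A B U(1) have "\<exists>i m W. i < k \<and> m < k \<and> W True \<subseteq> A \<and> W False \<subseteq> U - A \<and>
      joined {e \<in> E. \<chi> e = i} (100 ^ m * n) W \<and> (\<forall>s. 100 * (100 ^ m * n) \<le> card (W s))"
    by (intro joined_colour_pair[of V]) auto
  then obtain i m W where W: "i < k" "m < k" "W True \<subseteq> A" "W False \<subseteq> U - A"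
    "joined {e \<in> E. \<chi> e = i} (100 ^ m * n) W" and "\<forall>s. 100 * (100 ^ m * n) \<le> card (W s)"
    by (elim exE conjE)
  then have big: "100 * (100 ^ m * n) \<le> card (W s)" for s by simp
  have "100 ^ m \<le> (100 :: nat) ^ k" using W(2) by (intro power_increasing) auto
  then have "100 ^ m * n \<le> 100 ^ k * n" by simp
  moreover have "n \<le> 100 ^ m * n" by simp
  ultimately obtain h where h': "100 ^ m * n \<le> 2 ^ h" "2 ^ h \<le> 2 * (100 ^ m * n)" "2 * h + 3 + 2 * r \<le> n"
    using h by blast
  have WU: "W True \<subseteq> U" "W False \<subseteq> U" "W True \<inter> W False = {}" using W(3,4) A(1) by blast+
  have "finite (W s)" for s using WU(1,2) finU by (cases s) (simp_all add: finite_subset)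
  from joined_imp_linked[OF this WU(3) W(5) big h' \<open>n \<le> 100 ^ m * n\<close>]
  obtain Q where "Q \<subseteq> W True \<union> W False" "linked {e \<in> E. \<chi> e = i} n (2 * r) Q" by (elim exE conjE)
  then show False using U(3)[OF W(1), of Q] WU by blast
qed

section \<open>Choice of parameters\<close>

text \<open>Let \<open>2 ^ h\<close> be the least power of two above \<mu>. As \<mu> is at most
  linear in \<open>n\<close>, \<open>2 * h\<close> is logarithmic in \<open>n\<close>.\<close>

lemma cycle_length_large:
  fixes c r :: nat
  shows "\<exists>n0. \<forall>n\<ge>n0. 2 ^ r < n \<and> 2 * r \<le> n \<and>
    (\<forall>\<mu>. n \<le> \<mu> \<longrightarrow> \<mu> \<le> c * n \<longrightarrow> (\<exists>h. \<mu> \<le> 2 ^ h \<and> 2 ^ h \<le> 2 * \<mu> \<and> 2 * h + 3 + 2 * r \<le> n))"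
proof -
  \<comment> \<open>If the bound on \<open>h\<close> fails, then \<open>2 ^ n\<close> is at most
    \<open>(2 * c * n) ^ 2 * 2 ^ (2 * r + 2)\<close>, which is \<open>K * n ^ 2\<close>.\<close>
  define K where "K = 4 * c\<^sup>2 * 2 ^ (2 * r + 2)"
  have grow: "K * n\<^sup>2 < 2 ^ n" if "3 * (25 * K + 1) \<le> n" for n
  proof -
    \<comment> \<open>Cubing \<open>q < 2 ^ q\<close> gives \<open>q ^ 3 < 2 ^ n\<close>, and a
      factor \<open>q > 25 * K\<close> beats the constant.\<close>
    define q where "q = n div 3"
    have "25 * K < q" "n < 3 * q + 3" using that by (auto simp: q_def)
    then have q: "25 * K < q" "n \<le> 5 * q" "3 * q \<le> n" by (auto simp: q_def)
    have "K * n\<^sup>2 \<le> K * (5 * q)\<^sup>2" using q(2) by (intro mult_le_mono2 power_mono) auto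
    also have "\<dots> = 25 * K * q\<^sup>2" by (simp add: power_mult_distrib)
    also have "\<dots> \<le> q * q\<^sup>2" using q(1) by (intro mult_le_mono1) simp
    also have "\<dots> = q ^ 3" by (simp add: power2_eq_square power3_eq_cube)
    also have "\<dots> < (2 ^ q) ^ 3" by (intro power_strict_mono) auto
    also have "\<dots> = 2 ^ (3 * q)" by (simp add: power_mult mult.commute flip: power_mult)
    also have "\<dots> \<le> 2 ^ n" using q(3) by (intro power_increasing) auto
    finally show ?thesis .
  qed
  have "\<exists>h. \<mu> \<le> 2 ^ h \<and> 2 ^ h \<le> 2 * \<mu> \<and> 2 * h + 3 + 2 * r \<le> n"
    if n: "3 * (25 * K + 1) \<le> n" and \<mu>: "n \<le> \<mu>" "\<mu> \<le> c * n" for n \<mu>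
  proof -
    obtain g where g: "2 ^ g \<le> \<mu>" "\<mu> < 2 ^ (g + 1)"
      using ex_power_ivl1[of 2 \<mu>] n \<mu> by auto
    have "2 * (g + 1) + 3 + 2 * r \<le> n"
    proof (rule ccontr)
      assume "\<not> ?thesis"
      then have "(2 :: nat) ^ n \<le> 2 ^ ((g + 1) * 2 + (2 * r + 2))" by (intro power_increasing) auto
      also have "\<dots> = (2 ^ (g + 1))\<^sup>2 * 2 ^ (2 * r + 2)" by (simp only: power_add power_mult)
      also have "\<dots> \<le> (2 * (c * n))\<^sup>2 * 2 ^ (2 * r + 2)"
        using g \<mu> by (intro mult_le_mono1 power_mono) auto
      also have "\<dots> = K * n\<^sup>2" by (simp add: K_def power_mult_distrib)
      finally show False using grow[OF n] by simp
    qed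
    then show ?thesis using g by (intro exI[of _ "g + 1"]) auto
  qed
  then show ?thesis
    by (intro exI[of _ "3 * (25 * K + 1) + 2 ^ r + 2 * r + 1"]) auto
qed

theorem theorem1p2:
  shows "\<exists>C :: real. C > 0 \<and>
    (\<forall>k :: nat. k \<ge> 1 \<longrightarrow>
      (\<exists>n0 :: nat. \<forall>n :: nat. n \<ge> n0 \<longrightarrow>
        ereal_of_enat (size_ramsey k (cycle_graph n)) \<le> ereal (exp (C * real k) * real n)))"
\<comment> \<open>The host has at most \<open>3 * L ^ 3 * n\<close> edges with
  \<open>L = 2 * 600 ^ k\<close>, and \<open>3 * L ^ 3 = 24 * (600 ^ 3) ^ k\<close> is at most
  \<open>(24 * 600 ^ 3) ^ k\<close> for \<open>k \<ge> 1\<close>.\<close>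
proof (intro exI[of _ "ln (24 * 600 ^ 3)"] conjI allI impI)
  show "ln (24 * 600 ^ 3) > (0 :: real)" by (subst ln_gt_zero_iff) auto
  fix k :: nat
  assume k: "k \<ge> 1"
  define L :: nat where "L = 2 * 600 ^ k"
  \<comment> \<open>Enough rounds of growth by 3/2 to outgrow a host \<open>L\<close> times as large
    as a linked set.\<close>
  obtain r where r: "2 ^ r * L < (3 :: nat) ^ r"
  proof -
    obtain r where "real L < (3 / 2) ^ r" using real_arch_pow[of "3 / 2" "real L"] by auto
    then have "real (2 ^ r * L) < real (3 ^ r)" by (simp add: power_divide field_simps)
    then show ?thesis by (intro that[of r]) (simp only: of_nat_less_iff)
  qed
  have L1: "1 \<le> L" by (simp add: L_def)
  then have r1: "1 \<le> r" using r by (cases r) auto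
  from cycle_length_large[of r "100 ^ k"] obtain n0 where n0: "\<forall>n\<ge>n0. 2 ^ r < n \<and> 2 * r \<le> n \<and>
    (\<forall>\<mu>. n \<le> \<mu> \<longrightarrow> \<mu> \<le> 100 ^ k * n \<longrightarrow>
      (\<exists>h. \<mu> \<le> 2 ^ h \<and> 2 ^ h \<le> 2 * \<mu> \<and> 2 * h + 3 + 2 * r \<le> n))" by (elim exE)
  show "\<exists>n0. \<forall>n\<ge>n0. ereal_of_enat (size_ramsey k (cycle_graph n))
      \<le> ereal (exp (ln (24 * 600 ^ 3) * real k) * real n)"
  proof (intro exI[of _ n0] allI impI)
    fix n assume "n0 \<le> n"
    note n = n0[rule_format, OF this]
    have "1 \<le> n" using n by simp
    from sparse_joined_graph[OF L1 this] obtain E where E: "E \<subseteq> nsets {..<L * n} 2" "card E \<le> 3 * L ^ 3 * n"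
      and "\<forall>X Y. X \<subseteq> {..<L * n} \<and> Y \<subseteq> {..<L * n} \<and> X \<inter> Y = {} \<and> n \<le> card X \<and> n \<le> card Y \<longrightarrow>
        (\<exists>x\<in>X. \<exists>y\<in>Y. {x, y} \<in> E)"
      by (elim exE conjE)
    then have host: "\<exists>x\<in>X. \<exists>y\<in>Y. {x, y} \<in> E"
      if "X \<subseteq> {..<L * n}" "Y \<subseteq> {..<L * n}" "X \<inter> Y = {}" "n \<le> card X" "n \<le> card Y" for X Y
      using that by simp
    have "ramsey_for k \<lparr>uverts = {..<L * n}, uedges = E\<rparr> (cycle_graph n)"
      by (rule joined_host_ramsey[where r = r, OF _ _ host]) (use n r r1 in \<open>simp_all add: L_def\<close>)
    moreover have "simple_graph \<lparr>uverts = {..<L * n}, uedges = E\<rparr>"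
      using E(1) by (simp add: simple_graph_def)
    ultimately have "size_ramsey k (cycle_graph n) \<le> enat (3 * L ^ 3 * n)"
      unfolding size_ramsey_le_iff using E(2) by (metis ugraph.select_convs(2))
    then have "ereal_of_enat (size_ramsey k (cycle_graph n)) \<le> ereal_of_enat (enat (3 * L ^ 3 * n))"
      by (simp only: ereal_of_enat_le_iff)
    also have "\<dots> = ereal (real (3 * L ^ 3 * n))" by simp
    also have "\<dots> \<le> ereal (exp (ln (24 * 600 ^ 3) * real k) * real n)"
    proof -
      have "exp (ln (24 * 600 ^ 3) * real k) = exp (ln (24 * 600 ^ 3 :: real)) ^ k"
        by (simp only: exp_of_nat2_mult)
      also have "exp (ln (24 * 600 ^ 3 :: real)) = 24 * 600 ^ 3" by (rule exp_ln) simp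
      finally have "exp (ln (24 * 600 ^ 3) * real k) = 24 ^ k * (600 ^ 3) ^ k"
        by (simp only: power_mult_distrib)
      moreover have "(24 :: real) ^ 1 \<le> 24 ^ k" using k by (intro power_increasing) auto
      moreover have "real (3 * L ^ 3) = 24 * (600 ^ 3) ^ k"
        using power_mult[of "600 :: real" 3 k]
        by (simp add: L_def power_mult_distrib mult.commute flip: power_mult)
      ultimately have "real (3 * L ^ 3) \<le> exp (ln (24 * 600 ^ 3) * real k)"
        by (simp only: power_one_right mult_right_mono zero_le_power zero_le_numeral)
      then have "real (3 * L ^ 3) * real n \<le> exp (ln (24 * 600 ^ 3) * real k) * real n"
        by (rule mult_right_mono) simp
      then show ?thesis by simp
    qed
    finally show "ereal_of_enat (size_ramsey k (cycle_graph n))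
      \<le> ereal (exp (ln (24 * 600 ^ 3) * real k) * real n)" .
  qed
qed

end
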